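(* Let $\mathcal G_I\in\mathbb C\langle\langle e_0,e_1\rangle\rangle$ be the universal Hodge defect series, i.e. the series whose evaluation at $(N_0^{(w)},N_1^{(w)})$ is the matrix $\mathcal G_I(\mathcal E_w)$ of the Hodge defect for every word $w$ in $0,1$. Let $A=G_1^{-1}G_0$ be the Drinfeld associator, and write $$A=1+e_0a_0+e_1a_1,\qquad A^{-1}=1+e_0b_0+e_1b_1$$ for the leftmost-letter decompositions. Put $U(e_1)=\sum_{m\ge0}\frac{(-2\pi i)^m e_1^m}{(m+1)!}$. Then $$\mathcal G_I=(1+e_0a_0)\,A^{-1}\,U(e_1)=(1+e_1b_1)\,U(e_1).$$ The coefficients of $\mathcal G_I$ belong to the ($\mathbb Q$-)algebra generated by multiple zeta values and $2\pi i$. The coefficients of $\mathcal G_I\,U(e_1)^{-1}$ are precisely the constant term and the coefficients of $A^{-1}$ on words beginning in $e_1$ (on the left); that is, $\mathcal G_I\,U(e_1)^{-1}=1+e_1b_1$.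
   Context: Notation: $\omega_0=dz/z$, $\omega_1=dz/(1-z)$. $\mathbb C\langle\langle e_0,e_1\rangle\rangle$ is the algebra of formal power series in noncommuting variables $e_0,e_1$; a word $i_1\cdots i_n$ in the symbols $0,1$ stands for the monomial $e_{i_1}\cdots e_{i_n}$. Integrals and limits of series are taken coefficientwise. Canonical solutions and associator. Consider the equation $dG=(e_0\omega_0+e_1\omega_1)G$ for a $\mathbb C\langle\langle e_0,e_1\rangle\rangle$-valued function on $0<z<1$, with real logarithms. $G_0$ and $G_1$ are the solutions characterized by $G_0(z)z^{-e_0}\to1$ as $z\to0$ and $G_1(z)(1-z)^{e_1}\to1$ as $z\to1$. The constant series $A=G_1^{-1}G_0$ is the Drinfeld associator in this convention. Word matrices. For a word $w=i_1\cdots i_n$, $i_r\in\{0,1\}$, let $E_w$ be the complex vector space with basis $q_0,\dots,q_n$, and for $a\in\{0,1\}$ define the nilpotent operators $N_a^{(w)}$ by $N_a^{(w)}q_r=q_{r+1}$ if $0\le r<n$ and $a=i_{n-r}$, $N_a^{(w)}q_r=0$ if $0\le r<n$ and $a\ne i_{n-r}$, and $N_a^{(w)}q_n=0$. Matrices act on columns. The $(n,0)$-entry of a noncommutative series evaluated at $e_a\mapsto N_a^{(w)}$ is its coefficient of $w$, and the $(b,a)$-entry with $b>a$ is its coefficient of $i_{n-b+1}\cdots i_{n-a}$. $\mathcal E_w$ denotes the logarithmic connection $d-N_0^{(w)}\omega_0-N_1^{(w)}\omega_1$ on $E_w\otimes\mathcal O$ over $\mathbb P^1\setminus\{0,1,\infty\}$.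 Hodge defect matrix. For nilpotent matrices $N_0,N_1$ raising a finite grading by one, the matrix of the Hodge defect is $$(1+N_0-N_1)\Bigl(\int_0^1G_1(t)\,dt\Bigr)U_1,\qquad U_1=\sum_{m\ge0}\frac{(-2\pi iN_1)^m}{(m+1)!},$$ where $G_1$ is here the matrix solution obtained by substituting $e_a\mapsto N_a$. For a unipotent variation of mixed Hodge–Tate structures on $\mathbb P^1\setminus\{0,1,\infty\}$ with connection $d-N_0\omega_0-N_1\omega_1$, this is the matrix measuring the failure of the shrinking isomorphism along $[0,1]$ (from vanishing cycles at $1$ to the cohomology of the extension by $*$ at $0,1$ and $!$ at $\infty$) to respect Hodge filtrations. For a word, $\mathcal G_I(\mathcal E_w)$ is by definition this expression evaluated at $N_0=N_0^{(w)}$, $N_1=N_1^{(w)}$. Hence the universal series $\mathcal G_I$ is the series $(1+e_0-e_1)\bigl(\int_0^1G_1(t)\,dt\bigr)U(e_1)$. Multiple zeta values are the real numbers $\zeta(k_1,\dots,k_d)=\sum_{0<n_1<\cdots<n_d}n_1^{-k_1}\cdots n_d^{-k_d}$ with integers $k_i\ge1$, $k_d\ge2$. *)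

theory Defs
  imports
    "HOL-Analysis.Analysis"
    "HOL-Computational_Algebra.Formal_Power_Series"
    "Jordan_Normal_Form.Matrix"
begin

section \<open>Noncommutative formal power series in two variables\<close>

text \<open>\<open>L0\<close> and \<open>L1\<close> are the symbols 0 and 1; the word \<open>[i\<^sub>1, \<dots>, i\<^sub>n]\<close> stands for the
  monomial \<open>e\<^sub>i\<^sub>1 \<cdots> e\<^sub>i\<^sub>n\<close>, leftmost letter first.\<close>

datatype letter = L0 | L1

typedef ncps = "UNIV :: (letter list \<Rightarrow> complex) set"
  morphisms nc_coeff Ncps
  by simp

lemma nc_coeff_Ncps [simp]: "nc_coeff (Ncps f) = f"
  by (simp add: Ncps_inverse)

lemma ncps_eqI: "(\<And>w. nc_coeff f w = nc_coeff g w) \<Longrightarrow> f = g"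
  by (metis ext nc_coeff_inverse)

instantiation ncps :: ring_1
begin

definition "0 = Ncps (\<lambda>w. 0)"
definition "1 = Ncps (\<lambda>w. if w = [] then 1 else 0)"
definition "f + g = Ncps (\<lambda>w. nc_coeff f w + nc_coeff g w)"
definition "f - g = Ncps (\<lambda>w. nc_coeff f w - nc_coeff g w)"
definition "- f = Ncps (\<lambda>w. - nc_coeff f w)"
definition "f * g = Ncps (\<lambda>w. \<Sum>k\<le>length w. nc_coeff f (take k w) * nc_coeff g (drop k w))"

instance
proof
  fix f g h :: ncps
  show "f * g * h = f * (g * h)"
  proof (rule ncps_eqI)
    fix w :: "letter list"
    define F where "F i j (l::nat) =
      nc_coeff f (take i w) * nc_coeff g (take j (drop i w)) * nc_coeff h (drop (i + j) w)"
      for i j l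
    have "nc_coeff (f * g * h) w = (\<Sum>k=0..length w. \<Sum>i=0..k. F i (k - i) (length w - k))"
      by (auto simp: times_ncps_def F_def atMost_atLeast0 sum_distrib_right min_absorb2 min_absorb1 drop_take
          intro!: sum.cong)
    also have "\<dots> = (\<Sum>k=0..length w. \<Sum>i=0..length w - k. F k i (length w - k - i))"
      by (rule fps_mult_assoc_lemma)
    also have "\<dots> = nc_coeff (f * (g * h)) w"
      by (auto simp: times_ncps_def F_def atMost_atLeast0 sum_distrib_left add.commute mult.assoc
          intro!: sum.cong)
    finally show "nc_coeff (f * g * h) w = nc_coeff (f * (g * h)) w" .
  qed
  show "1 * f = f"
  proof (rule ncps_eqI)
    fix w :: "letter list"
    have "nc_coeff (1 * f) w = (\<Sum>k\<le>length w. if k = 0 then nc_coeff f w else 0)"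
      unfolding times_ncps_def one_ncps_def nc_coeff_Ncps by (intro sum.cong) auto
    thus "nc_coeff (1 * f) w = nc_coeff f w" by simp
  qed
  show "f * 1 = f"
  proof (rule ncps_eqI)
    fix w :: "letter list"
    have "nc_coeff (f * 1) w = (\<Sum>k\<le>length w. if k = length w then nc_coeff f w else 0)"
      unfolding times_ncps_def one_ncps_def nc_coeff_Ncps by (intro sum.cong) auto
    thus "nc_coeff (f * 1) w = nc_coeff f w" by simp
  qed
  show "(0::ncps) \<noteq> 1"
  proof
    assume "(0::ncps) = 1"
    hence "nc_coeff 0 [] = nc_coeff 1 []" by simp
    thus False by (simp add: zero_ncps_def one_ncps_def)
  qed
qed (auto intro!: ncps_eqI simp: plus_ncps_def minus_ncps_def uminus_ncps_def zero_ncps_def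
      times_ncps_def algebra_simps sum.distrib)

end

definition nc_smult :: "complex \<Rightarrow> ncps \<Rightarrow> ncps" where
  "nc_smult c f = Ncps (\<lambda>w. c * nc_coeff f w)"

text \<open>The series \<open>\<Sum>m. c m e\<^sub>a\<^sup>m\<close> in a single variable.\<close>

definition nc_letter_series :: "letter \<Rightarrow> (nat \<Rightarrow> complex) \<Rightarrow> ncps" where
  "nc_letter_series a c = Ncps (\<lambda>w. if w = replicate (length w) a then c (length w) else 0)"

definition nc_var :: "letter \<Rightarrow> ncps" where
  "nc_var a = Ncps (\<lambda>w. if w = [a] then 1 else 0)"

abbreviation e0 :: ncps where "e0 \<equiv> nc_var L0"
abbreviation e1 :: ncps where "e1 \<equiv> nc_var L1"

definition nc_inv :: "ncps \<Rightarrow> ncps" where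
  "nc_inv f = (THE g. f * g = 1 \<and> g * f = 1)"


section \<open>Canonical solutions and the associator\<close>

definition nc_powr :: "real \<Rightarrow> real \<Rightarrow> letter \<Rightarrow> ncps" where
  \<comment> \<open>\<open>x\<^bsup>s e\<^sub>a\<^esup> = exp (s log x e\<^sub>a)\<close> for \<open>x > 0\<close>\<close>
  "nc_powr x s a = nc_letter_series a (\<lambda>m. of_real ((s * ln x) ^ m / fact m))"

definition kz_solution :: "(real \<Rightarrow> ncps) \<Rightarrow> bool" where
  "kz_solution G \<longleftrightarrow> (\<forall>z\<in>{0<..<1}. \<forall>w.
     ((\<lambda>t. nc_coeff (G t) w) has_vector_derivative
       nc_coeff ((nc_smult (of_real (1 / z)) e0 + nc_smult (of_real (1 / (1 - z))) e1) * G z) w)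
     (at z))"

text \<open>The canonical solutions live on the open interval; they are given the value 0 elsewhere
  to make them unique as functions on all reals.\<close>

definition G0 :: "real \<Rightarrow> ncps" where
  "G0 = (THE G. kz_solution G \<and> (\<forall>z. z \<notin> {0<..<1} \<longrightarrow> G z = 0) \<and>
     (\<forall>w. ((\<lambda>z. nc_coeff (G z * nc_powr z (-1) L0) w) \<longlongrightarrow> nc_coeff 1 w) (at_right 0)))"

definition G1 :: "real \<Rightarrow> ncps" where
  "G1 = (THE G. kz_solution G \<and> (\<forall>z. z \<notin> {0<..<1} \<longrightarrow> G z = 0) \<and>
     (\<forall>w. ((\<lambda>z. nc_coeff (G z * nc_powr (1 - z) 1 L1) w) \<longlongrightarrow> nc_coeff 1 w) (at_left 1)))"

definition associator :: ncps where
  "associator = (THE A. \<forall>z\<in>{0<..<1}. A = nc_inv (G1 z) * G0 z)"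


section \<open>Evaluation at matrices and the Hodge defect\<close>

text \<open>A family \<open>N\<close> consists of two square matrices of the same size, \<open>N L0 = N\<^sub>0\<close> and
  \<open>N L1 = N\<^sub>1\<close>. The sums below are meant for \<open>N\<close> raising a finite grading by one, in which
  case only finitely many terms are nonzero.\<close>

primrec word_prod :: "(letter \<Rightarrow> complex mat) \<Rightarrow> letter list \<Rightarrow> complex mat" where
  "word_prod N [] = 1\<^sub>m (dim_row (N L0))"
| "word_prod N (a # u) = N a * word_prod N u"

definition nc_eval :: "(letter \<Rightarrow> complex mat) \<Rightarrow> ncps \<Rightarrow> complex mat" where
  "nc_eval N f = mat (dim_row (N L0)) (dim_row (N L0))
     (\<lambda>(i, j). \<Sum>\<^sub>\<infinity>u. nc_coeff f u * word_prod N u $$ (i, j))"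

text \<open>On \<open>E\<^sub>w\<close> the operator \<open>N\<^sub>a\<close> sends \<open>q\<^sub>r\<close> to \<open>q\<^sub>r\<^sub>+\<^sub>1\<close> if the letter \<open>i\<^sub>n\<^sub>-\<^sub>r\<close> of \<open>w\<close>, counted from 1,
  is \<open>a\<close>. In the column of \<open>q\<^sub>r\<close>, this is the entry in row \<open>b = r + 1\<close>, and the letter is
  \<open>w ! (n - b)\<close>, counted from 0.\<close>

definition word_matrix :: "letter list \<Rightarrow> letter \<Rightarrow> complex mat" where
  "word_matrix w a = mat (length w + 1) (length w + 1)
     (\<lambda>(b, r). if b = r + 1 \<and> w ! (length w - b) = a then 1 else 0)"

definition hodge_defect_matrix :: "(letter \<Rightarrow> complex mat) \<Rightarrow> complex mat" where
  "hodge_defect_matrix N =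
    (let d = dim_row (N L0);
         intG1 = mat d d (\<lambda>(i, j). LINT t:{0<..<1}|lborel. nc_eval N (G1 t) $$ (i, j));
         U1 = mat d d (\<lambda>(i, j).
           \<Sum>m. (((- 2 * of_real pi * \<i>) \<cdot>\<^sub>m N L1) ^\<^sub>m m) $$ (i, j) / fact (m + 1))
     in (1\<^sub>m d + N L0 - N L1) * intG1 * U1)"

definition hodge_defect_series :: ncps where
  "hodge_defect_series =
    (THE G. \<forall>w. nc_eval (word_matrix w) G = hodge_defect_matrix (word_matrix w))"

definition U_e1 :: ncps where
  "U_e1 = nc_letter_series L1 (\<lambda>m. (- 2 * of_real pi * \<i>) ^ m / fact (m + 1))"


section \<open>Multiple zeta values\<close>

definition mzv_index :: "nat list \<Rightarrow> bool" where
  "mzv_index ks \<longleftrightarrow> ks \<noteq> [] \<and> (\<forall>k\<in>set ks. k \<ge> 1) \<and> last ks \<ge> 2"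

definition mzv :: "nat list \<Rightarrow> real" where
  "mzv ks = (\<Sum>\<^sub>\<infinity>ns\<in>{ns :: nat list. length ns = length ks \<and> sorted_wrt (<) ns \<and> (\<forall>n\<in>set ns. 0 < n)}.
     \<Prod>j<length ks. 1 / real (ns ! j) ^ (ks ! j))"

inductive_set rat_algebra :: "complex set \<Rightarrow> complex set" for S :: "complex set" where
  scalar: "of_rat q \<in> rat_algebra S"
| gen: "x \<in> S \<Longrightarrow> x \<in> rat_algebra S"
| add: "x \<in> rat_algebra S \<Longrightarrow> y \<in> rat_algebra S \<Longrightarrow> x + y \<in> rat_algebra S"
| mult: "x \<in> rat_algebra S \<Longrightarrow> y \<in> rat_algebra S \<Longrightarrow> x * y \<in> rat_algebra S"

definition mzv_algebra :: "complex set" where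
  \<comment> \<open>generated over the rationals by the multiple zeta values and \<open>2\<pi>i\<close>\<close>
  "mzv_algebra =
    rat_algebra ({of_real (mzv ks) | ks. mzv_index ks} \<union> {2 * of_real pi * \<i>})"

end

theory Submission
  imports Defs "HOL-Real_Asymp.Real_Asymp"
begin

text \<open>Write \<open>G\<^sub>0 = H(z) z\<^bsup>e\<^sub>0\<^esup>\<close>: the coefficients of the power series \<open>H\<close> satisfy a recursion, on words
  ending in 1 they are the nested sums that define multiple zeta values, and \<open>G\<^sub>1\<close> is obtained from
  \<open>G\<^sub>0\<close> by \<open>z \<mapsto> 1 - z\<close>, \<open>e\<^sub>0 \<leftrightarrow> -e\<^sub>1\<close>. Integrating the derivative of \<open>z G\<^sub>1\<close> minus the part \<open>P\<close> of \<open>G\<^sub>1\<close> on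
  words beginning with \<open>e\<^sub>1\<close> gives \<open>(1 + e\<^sub>0 - e\<^sub>1) (\<integral> G\<^sub>1) = 1 + P(0)\<close>, and \<open>P(0) = e\<^sub>1 b\<^sub>1\<close> because
  \<open>G\<^sub>1 = G\<^sub>0 A\<^sup>-\<^sup>1\<close> and the part of \<open>G\<^sub>0\<close> on words beginning with \<open>e\<^sub>1\<close> vanishes at 0. The regularized values on
  words ending in 0 reduce to the others by the derivation that inserts the letter 0, under which
  \<open>G\<^sub>0\<close> is multiplied by \<open>log z\<close>, hence by something that vanishes at 1.\<close>

section \<open>The algebra of noncommutative series\<close>

text \<open>The factor \<open>1 + e0 - e1\<close> comes from z/(1-z) = 1/(1-z) - 1: the derivative
  of z G_1 is (1 + e_0 - e_1) G_1 plus e_1 G_1/(1-z), and the last term is the derivative of P. The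
  obstacle is that coefficients of solutions can grow like powers of logarithms at both end points.
  These powers are never tracked. All growth estimates use an inverse square root, of the index n or
  of the distance to an end point: the recursion for H and integration of the equation both
  reproduce a bound of this shape, and it is strong enough for integrability, for the vanishing of
  boundary terms and for convergence of the needed series at z = 1. The words that matter cause no
  divergence at 1: P lives on words beginning with e_1, the symmetry turns them into words beginning
  with e_0, and on those G_0 has a finite limit at 1. Hence only trailing zeros call for
  regularization. The equality of the two products in the theorem is pure algebra: it is A A^(-1) =
  1 read on words beginning with e_1.\<close>

definition nc_tail :: "letter \<Rightarrow> ncps \<Rightarrow> ncps" where
  "nc_tail a f = Ncps (\<lambda>u. nc_coeff f (a # u))"

lemma nc_coeff_tail [simp]: "nc_coeff (nc_tail a f) u = nc_coeff f (a # u)"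
  by (simp add: nc_tail_def)

lemma nc_coeff_zero [simp]: "nc_coeff 0 w = 0"
  by (simp add: zero_ncps_def)

lemma nc_coeff_one: "nc_coeff 1 w = (if w = [] then 1 else 0)"
  by (simp add: one_ncps_def)

lemma nc_coeff_add [simp]: "nc_coeff (f + g) w = nc_coeff f w + nc_coeff g w"
  by (simp add: plus_ncps_def)

lemma nc_coeff_diff [simp]: "nc_coeff (f - g) w = nc_coeff f w - nc_coeff g w"
  by (simp add: minus_ncps_def)

lemma nc_coeff_smult [simp]: "nc_coeff (nc_smult c f) w = c * nc_coeff f w"
  by (simp add: nc_smult_def)

lemma nc_coeff_mult:
  "nc_coeff (f * g) w = (\<Sum>k\<le>length w. nc_coeff f (take k w) * nc_coeff g (drop k w))"
  by (simp add: times_ncps_def)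

lemma nc_coeff_mult_Nil [simp]: "nc_coeff (f * g) [] = nc_coeff f [] * nc_coeff g []"
  by (simp add: nc_coeff_mult)

text \<open>Separates the splitting with empty prefix. The rest is again a product, which allows
  product identities to be proved by induction on the word.\<close>

lemma nc_coeff_mult_Cons:
  "nc_coeff (f * g) (a # u) = nc_coeff f [] * nc_coeff g (a # u) + nc_coeff (nc_tail a f * g) u"
  by (simp add: nc_coeff_mult sum.atMost_Suc_shift del: sum.atMost_Suc)

lemma nc_coeff_sum [simp]: "nc_coeff (sum F I) w = (\<Sum>i\<in>I. nc_coeff (F i) w)"
  by (induction I rule: infinite_finite_induct) auto

lemma nc_smult_mult_left: "nc_smult c f * g = nc_smult c (f * g)"
  by (rule ncps_eqI) (simp add: nc_coeff_mult sum_distrib_left mult.assoc)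

lemma nc_smult_mult_right: "f * nc_smult c g = nc_smult c (f * g)"
  by (rule ncps_eqI) (simp add: nc_coeff_mult sum_distrib_left mult_ac)

lemma nc_coeff_var_Nil [simp]: "nc_coeff (nc_var a) [] = 0"
  by (simp add: nc_var_def)

lemma nc_coeff_var_mult_Cons [simp]:
  "nc_coeff (nc_var a * f) (b # u) = (if a = b then nc_coeff f u else 0)"
proof -
  have "nc_tail b (nc_var a) = (if a = b then 1 else 0)"
    by (auto intro!: ncps_eqI simp: nc_var_def nc_coeff_one)
  thus ?thesis by (simp add: nc_coeff_mult_Cons)
qed

lemma nc_coeff_mult_var_snoc [simp]:
  "nc_coeff (f * nc_var a) (u @ [b]) = (if a = b then nc_coeff f u else 0)"
proof -
  have "nc_coeff (f * nc_var a) (u @ [b]) =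
      (\<Sum>k\<le>Suc (length u). if k = length u then (if a = b then nc_coeff f u else 0) else 0)"
    unfolding nc_coeff_mult length_append_singleton
  proof (rule sum.cong)
    fix k assume "k \<in> {..Suc (length u)}"
    then consider "k < length u" | "k = length u" | "k = Suc (length u)" by fastforce
    thus "nc_coeff f (take k (u @ [b])) * nc_coeff (nc_var a) (drop k (u @ [b])) =
        (if k = length u then (if a = b then nc_coeff f u else 0) else 0)"
      by cases (auto simp: nc_var_def append_eq_Cons_conv)
  qed auto
  thus ?thesis by simp
qed

lemma nc_tail_decomp:
  assumes "nc_coeff f [] = 1"
  shows "f = 1 + e0 * nc_tail L0 f + e1 * nc_tail L1 f"
proof (rule ncps_eqI)
  fix w show "nc_coeff f w = nc_coeff (1 + e0 * nc_tail L0 f + e1 * nc_tail L1 f) w"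
    using assms by (cases w; cases "hd w") (auto simp: nc_coeff_one)
qed

subsection \<open>Inverses\<close>

text \<open>The equation f * g = 1 at \<open>w\<close>, solved for the splitting with empty prefix;
  all other splittings involve shorter suffixes of \<open>w\<close>.\<close>

fun nc_rinv_coeff :: "ncps \<Rightarrow> letter list \<Rightarrow> complex" where
  "nc_rinv_coeff f w = (if w = [] then 1 else
     - (\<Sum>k\<in>{1..length w}. nc_coeff f (take k w) * nc_rinv_coeff f (drop k w)))"

declare nc_rinv_coeff.simps [simp del]

lemma nc_right_inverse:
  assumes "nc_coeff f [] = 1"
  obtains g where "nc_coeff g [] = 1" "f * g = 1"
proof
  let ?g = "Ncps (nc_rinv_coeff f)"
  show "nc_coeff ?g [] = 1" by (simp add: nc_rinv_coeff.simps)
  show "f * ?g = 1"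
  proof (rule ncps_eqI)
    fix w
    have "nc_coeff (f * ?g) w = nc_rinv_coeff f w +
        (\<Sum>k\<in>{1..length w}. nc_coeff f (take k w) * nc_rinv_coeff f (drop k w))"
      using assms by (simp add: nc_coeff_mult atMost_atLeast0 sum.atLeast_Suc_atMost)
    also have "\<dots> = nc_coeff 1 w"
      by (subst nc_rinv_coeff.simps) (simp add: nc_coeff_one)
    finally show "nc_coeff (f * ?g) w = nc_coeff 1 w" .
  qed
qed

text \<open>A right inverse \<open>g\<close> has a right inverse \<open>h\<close> of its own, and
  associativity forces h = f. So \<open>g\<close> is two-sided and unique, which the description in
  \<open>nc_inv_def\<close> requires.\<close>

lemma nc_inv:
  assumes "nc_coeff f [] = 1"
  shows nc_mult_inv: "f * nc_inv f = 1" and nc_inv_mult: "nc_inv f * f = 1"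
proof -
  obtain g where g: "nc_coeff g [] = 1" "f * g = 1" using nc_right_inverse assms by blast
  obtain h where h: "g * h = 1" using nc_right_inverse g(1) by blast
  have "h = (f * g) * h" by (simp add: g(2))
  hence "f = h" using h by (simp add: mult.assoc)
  hence "g * f = 1" using h by simp
  have "\<exists>!g. f * g = 1 \<and> g * f = 1"
  proof (rule ex1I [of _ g])
    fix k assume "f * k = 1 \<and> k * f = 1"
    hence "k = k * (f * g)" "(k * f) * g = g" by (simp_all add: g(2))
    thus "k = g" by (simp add: mult.assoc)
  qed (use g \<open>g * f = 1\<close> in auto)
  from theI' [OF this] show "f * nc_inv f = 1" "nc_inv f * f = 1"
    unfolding nc_inv_def by auto
qed

lemma nc_coeff_inv_Nil:
  assumes "nc_coeff f [] = 1"
  shows "nc_coeff (nc_inv f) [] = 1"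
  using arg_cong [OF nc_mult_inv [OF assms], of "\<lambda>h. nc_coeff h []"] assms
  by (simp add: nc_coeff_one)

subsection \<open>Series in one letter\<close>

lemma nc_letter_series_cong:
  "(\<And>m. c m = d m) \<Longrightarrow> nc_letter_series a c = nc_letter_series a d"
  by (metis ext)

lemma nc_coeff_letter_series:
  "nc_coeff (nc_letter_series a c) w = (if w = replicate (length w) a then c (length w) else 0)"
  by (simp add: nc_letter_series_def)

text \<open>The right-hand form passes to both parts of any splitting of \<open>w\<close> without
  mentioning lengths.\<close>

lemma eq_replicate_iff: "w = replicate (length w) a \<longleftrightarrow> set w \<subseteq> {a}"
  by (induction w) auto

lemma nc_letter_series_mult:
  "nc_letter_series a c * nc_letter_series a d = nc_letter_series a (\<lambda>m. \<Sum>k\<le>m. c k * d (m - k))"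
proof (rule ncps_eqI)
  fix w
  have *: "set w \<subseteq> {a} \<longleftrightarrow> set (take k w) \<subseteq> {a} \<and> set (drop k w) \<subseteq> {a}" for k
    by (metis append_take_drop_id le_sup_iff set_append)
  show "nc_coeff (nc_letter_series a c * nc_letter_series a d) w =
      nc_coeff (nc_letter_series a (\<lambda>m. \<Sum>k\<le>m. c k * d (m - k))) w"
    unfolding nc_coeff_mult nc_coeff_letter_series eq_replicate_iff
    by (cases "set w \<subseteq> {a}")
      (use * in \<open>auto intro!: sum.cong sum.neutral simp: min_absorb2 dest: in_set_takeD in_set_dropD\<close>)
qed

lemma nc_powr_mult: "nc_powr x s a * nc_powr x t a = nc_powr x (s + t) a"
  unfolding nc_powr_def nc_letter_series_mult
proof (rule nc_letter_series_cong)
  fix m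
  have "(\<Sum>k\<le>m. (s * ln x) ^ k / fact k * ((t * ln x) ^ (m - k) / fact (m - k))) =
      ((s + t) * ln x) ^ m / fact m"
    unfolding distrib_right binomial_ring sum_divide_distrib
    by (intro sum.cong) (auto simp: binomial_fact field_simps)
  from this [symmetric] show "(\<Sum>k\<le>m. complex_of_real ((s * ln x) ^ k / fact k) *
      complex_of_real ((t * ln x) ^ (m - k) / fact (m - k))) =
      complex_of_real (((s + t) * ln x) ^ m / fact m)"
    by (metis (mono_tags, lifting) of_real_mult of_real_sum sum.cong)
qed

lemma nc_powr_0 [simp]: "nc_powr x 0 a = 1"
  by (rule ncps_eqI)
    (auto simp: nc_powr_def nc_coeff_letter_series nc_coeff_one power_0_left)

lemma nc_coeff_powr_Nil [simp]: "nc_coeff (nc_powr x s a) [] = 1"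
  by (simp add: nc_powr_def nc_coeff_letter_series)

subsection \<open>Exchanging the two letters\<close>

fun swap_letter :: "letter \<Rightarrow> letter" where
  "swap_letter L0 = L1" | "swap_letter L1 = L0"

lemma swap_letter_swap [simp]: "swap_letter (swap_letter a) = a"
  by (cases a) auto

lemma map_swap_swap [simp]: "map swap_letter (map swap_letter w) = w"
  by (simp add: o_def)

text \<open>The algebra automorphism that sends \<open>e0\<close> to -\<open>e1\<close> and
  \<open>e1\<close> to -\<open>e0\<close>. The signs are there because z -> 1 - z turns dz/z into
  -dz/(1-z).\<close>

definition nc_swap :: "ncps \<Rightarrow> ncps" where
  "nc_swap f = Ncps (\<lambda>w. (-1) ^ length w * nc_coeff f (map swap_letter w))"

lemma nc_coeff_swap [simp]:
  "nc_coeff (nc_swap f) w = (-1) ^ length w * nc_coeff f (map swap_letter w)"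
  by (simp add: nc_swap_def)

lemma nc_swap_mult: "nc_swap (f * g) = nc_swap f * nc_swap g"
proof (rule ncps_eqI)
  fix w :: "letter list"
  have "(-1::complex) ^ length w = (-1) ^ k * (-1) ^ (length w - k)" if "k \<le> length w" for k
    using that by (simp flip: power_add)
  thus "nc_coeff (nc_swap (f * g)) w = nc_coeff (nc_swap f * nc_swap g) w"
    by (auto simp: nc_coeff_mult take_map drop_map sum_distrib_left min_absorb2 intro!: sum.cong)
qed

lemma nc_swap_one [simp]: "nc_swap 1 = 1"
  by (rule ncps_eqI) (simp add: nc_coeff_one)

lemma nc_swap_zero [simp]: "nc_swap 0 = 0"
  by (rule ncps_eqI) simp

lemma nc_swap_powr: "nc_swap (nc_powr x s a) = nc_powr x (- s) (swap_letter a)"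
proof (rule ncps_eqI)
  fix w
  have "map swap_letter w = replicate (length w) a \<longleftrightarrow> w = replicate (length w) (swap_letter a)"
    by (metis map_replicate map_swap_swap swap_letter_swap)
  moreover have "complex_of_real ((- s * ln x) ^ m) = (-1) ^ m * of_real ((s * ln x) ^ m)" for m
    by (simp add: power_minus [of "s * ln x"])
  ultimately show "nc_coeff (nc_swap (nc_powr x s a)) w = nc_coeff (nc_powr x (- s) (swap_letter a)) w"
    by (simp add: nc_powr_def nc_coeff_letter_series)
qed

subsection \<open>Insertion of a letter\<close>

text \<open>The derivation dual to the shuffle product with a single letter; it sends the variable
  of that letter to 1 and the other variable to 0.\<close>

definition nc_ins :: "letter \<Rightarrow> ncps \<Rightarrow> ncps" where
  "nc_ins a f = Ncps (\<lambda>w. \<Sum>i\<le>length w. nc_coeff f (take i w @ a # drop i w))"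

lemma nc_coeff_ins:
  "nc_coeff (nc_ins a f) w = (\<Sum>i\<le>length w. nc_coeff f (take i w @ a # drop i w))"
  by (simp add: nc_ins_def)

lemma nc_coeff_ins_Nil: "nc_coeff (nc_ins a f) [] = nc_coeff f [a]"
  by (simp add: nc_coeff_ins)

lemma nc_tail_ins: "nc_tail b (nc_ins a f) = nc_tail b (nc_tail a f) + nc_ins a (nc_tail b f)"
  by (rule ncps_eqI) (simp add: nc_coeff_ins sum.atMost_Suc_shift del: sum.atMost_Suc)

lemma nc_coeff_ins_Cons:
  "nc_coeff (nc_ins a f) (b # u) = nc_coeff f (a # b # u) + nc_coeff (nc_ins a (nc_tail b f)) u"
  using arg_cong [OF nc_tail_ins, of "\<lambda>h. nc_coeff h u"] by simp

lemma nc_ins_add: "nc_ins a (f + g) = nc_ins a f + nc_ins a g"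
  by (rule ncps_eqI) (simp add: nc_coeff_ins sum.distrib)

lemma nc_ins_diff: "nc_ins a (f - g) = nc_ins a f - nc_ins a g"
  by (rule ncps_eqI) (simp add: nc_coeff_ins sum_subtractf)

lemma nc_ins_smult: "nc_ins a (nc_smult c f) = nc_smult c (nc_ins a f)"
  by (rule ncps_eqI) (simp add: nc_coeff_ins sum_distrib_left)

lemma nc_tail_mult: "nc_tail b (f * g) = nc_smult (nc_coeff f []) (nc_tail b g) + nc_tail b f * g"
  by (rule ncps_eqI) (simp add: nc_coeff_mult_Cons)

text \<open>Inserting a letter and then splitting the word amounts to splitting it first and
  inserting into one of the two parts. The induction varies both factors because the first letter of
  the word passes to a tail of either one.\<close>

lemma nc_ins_mult: "nc_ins a (f * g) = nc_ins a f * g + f * nc_ins a g"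
proof (rule ncps_eqI)
  fix w show "nc_coeff (nc_ins a (f * g)) w = nc_coeff (nc_ins a f * g + f * nc_ins a g) w"
  proof (induction w arbitrary: f g)
    case Nil
    show ?case by (simp add: nc_coeff_ins_Nil nc_coeff_mult_Cons)
  next
    case (Cons b u)
    show ?case
      by (simp add: nc_coeff_ins_Cons nc_coeff_mult_Cons nc_tail_mult nc_ins_add nc_ins_smult Cons
          nc_tail_ins nc_coeff_ins_Nil algebra_simps)
  qed
qed

lemma nc_ins_var: "nc_ins a (nc_var b) = (if a = b then 1 else 0)"
proof (rule ncps_eqI)
  fix w show "nc_coeff (nc_ins a (nc_var b)) w = nc_coeff (if a = b then 1 else 0) w"
    by (cases w) (auto simp: nc_coeff_ins nc_var_def nc_coeff_one append_eq_Cons_conv intro!: sum.neutral)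
qed

lemma nc_ins_one [simp]: "nc_ins a 1 = 0"
  by (rule ncps_eqI) (simp add: nc_coeff_ins nc_coeff_one)

lemma nc_ins_sum: "nc_ins a (sum F I) = (\<Sum>i\<in>I. nc_ins a (F i))"
  by (rule ncps_eqI) (simp add: nc_coeff_ins sum.swap [of _ I])

text \<open>A power of \<open>a\<close> of length m has m + 1 slots, all giving the power of length
  m + 1, and (m + 1)/(m + 1)! = 1/m!.\<close>

lemma nc_ins_powr: "nc_ins a (nc_powr x s a) = nc_smult (of_real (s * ln x)) (nc_powr x s a)"
proof (rule ncps_eqI)
  fix w
  have *: "set w \<subseteq> {a} \<longleftrightarrow> set (take i w) \<subseteq> {a} \<and> set (drop i w) \<subseteq> {a}" for i
    by (metis append_take_drop_id le_sup_iff set_append)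
  have "nc_coeff (nc_ins a (nc_powr x s a)) w =
      (\<Sum>i\<le>length w. if set w \<subseteq> {a} then of_real ((s * ln x) ^ Suc (length w) / fact (Suc (length w))) else 0)"
    unfolding nc_coeff_ins nc_powr_def nc_coeff_letter_series eq_replicate_iff
  proof (rule sum.cong)
    fix i assume i: "i \<in> {..length w}"
    show "(if set (take i w @ a # drop i w) \<subseteq> {a}
        then complex_of_real ((s * ln x) ^ length (take i w @ a # drop i w) / fact (length (take i w @ a # drop i w))) else 0) =
       (if set w \<subseteq> {a} then of_real ((s * ln x) ^ Suc (length w) / fact (Suc (length w))) else 0)"
      using i * [of i] by (simp add: min_absorb2)
  qed simp
  also have "\<dots> = nc_coeff (nc_smult (of_real (s * ln x)) (nc_powr x s a)) w"
    by (simp add: nc_powr_def nc_coeff_letter_series eq_replicate_iff field_simps del: of_nat_Suc)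
  finally show "nc_coeff (nc_ins a (nc_powr x s a)) w =
      nc_coeff (nc_smult (of_real (s * ln x)) (nc_powr x s a)) w" .
qed

section \<open>Solutions of the differential equation\<close>

definition nc_has_deriv :: "(real \<Rightarrow> ncps) \<Rightarrow> ncps \<Rightarrow> real \<Rightarrow> bool" where
  "nc_has_deriv F F' z \<longleftrightarrow>
     (\<forall>w. ((\<lambda>t. nc_coeff (F t) w) has_vector_derivative nc_coeff F' w) (at z))"

definition kz_form :: "letter \<Rightarrow> real \<Rightarrow> real" where
  "kz_form a z = (case a of L0 \<Rightarrow> 1 / z | L1 \<Rightarrow> 1 / (1 - z))"

definition kz_field :: "real \<Rightarrow> ncps" where
  "kz_field z = nc_smult (of_real (1 / z)) e0 + nc_smult (of_real (1 / (1 - z))) e1"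

lemma nc_coeff_kz_field_Nil [simp]: "nc_coeff (kz_field z) [] = 0"
  by (simp add: kz_field_def)

lemma nc_coeff_kz_field_mult_Cons [simp]:
  "nc_coeff (kz_field z * f) (a # u) = of_real (kz_form a z) * nc_coeff f u"
  by (cases a) (auto simp: kz_field_def kz_form_def distrib_right nc_smult_mult_left)

lemma kz_solution_iff: "kz_solution G \<longleftrightarrow> (\<forall>z\<in>{0<..<1}. nc_has_deriv G (kz_field z * G z) z)"
  by (simp add: kz_solution_def nc_has_deriv_def kz_field_def)

lemma nc_has_deriv_mult:
  assumes "nc_has_deriv F F' z" "nc_has_deriv G G' z"
  shows "nc_has_deriv (\<lambda>t. F t * G t) (F' * G z + F z * G') z"
  unfolding nc_has_deriv_def nc_coeff_add nc_coeff_mult sum.distrib [symmetric]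
proof (intro allI has_vector_derivative_sum)
  fix w k
  show "((\<lambda>t. nc_coeff (F t) (take k w) * nc_coeff (G t) (drop k w)) has_vector_derivative
      nc_coeff F' (take k w) * nc_coeff (G z) (drop k w) +
      nc_coeff (F z) (take k w) * nc_coeff G' (drop k w)) (at z)"
    using has_vector_derivative_mult [of "\<lambda>t. nc_coeff (F t) (take k w)" _ z UNIV
        "\<lambda>t. nc_coeff (G t) (drop k w)"] assms
    by (simp add: nc_has_deriv_def add.commute)
qed

lemma nc_has_deriv_const: "nc_has_deriv (\<lambda>_. c) 0 z"
  by (simp add: nc_has_deriv_def)

section \<open>Operations on solutions, and uniqueness\<close>

lemma kz_solution_cong:
  assumes "kz_solution F" "\<And>z. z \<in> {0<..<1} \<Longrightarrow> F z = G z"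
  shows "kz_solution G"
  unfolding kz_solution_iff nc_has_deriv_def
proof (intro ballI allI)
  fix z :: real and w assume z: "z \<in> {0<..<1}"
  have "((\<lambda>t. nc_coeff (F t) w) has_vector_derivative nc_coeff (kz_field z * G z) w) (at z)"
    using assms(1) z unfolding kz_solution_iff nc_has_deriv_def assms(2) [OF z, symmetric] by blast
  thus "((\<lambda>t. nc_coeff (G t) w) has_vector_derivative nc_coeff (kz_field z * G z) w) (at z)"
    by (rule has_vector_derivative_transform_within_open [OF _ _ z]) (use assms in auto)
qed

lemma kz_solution_diff:
  assumes "kz_solution F" "kz_solution G"
  shows "kz_solution (\<lambda>z. F z - G z)"
  using assms by (auto simp: kz_solution_iff nc_has_deriv_def right_diff_distrib
      intro!: has_vector_derivative_diff)

lemma kz_solution_mult_const: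
  assumes "kz_solution F"
  shows "kz_solution (\<lambda>z. F z * c)"
  using assms nc_has_deriv_mult [OF _ nc_has_deriv_const]
  by (fastforce simp: kz_solution_iff mult.assoc)

text \<open>Removing the first letter makes the equation triangular: coefficients are iterated
  integrals, and arguments about solutions become inductions on the word.\<close>

lemma kz_solution_coeff:
  assumes "kz_solution G" "z \<in> {0<..<1}"
  shows kz_solution_Nil: "((\<lambda>t. nc_coeff (G t) []) has_vector_derivative 0) (at z)"
    and kz_solution_Cons: "((\<lambda>t. nc_coeff (G t) (a # u)) has_vector_derivative
      of_real (kz_form a z) * nc_coeff (G z) u) (at z)"
  using assms nc_coeff_mult_Nil [of "kz_field z" "G z"] nc_coeff_kz_field_mult_Cons
  unfolding kz_solution_iff nc_has_deriv_def nc_coeff_kz_field_Nil mult_zero_left by metis+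

text \<open>The common induction step of both uniqueness results. For the empty word the second
  hypothesis is vacuous, so that the constant term of any solution is constant.\<close>

lemma kz_solution_zero_derivative:
  assumes "kz_solution G" "\<And>u z. length u < length w \<Longrightarrow> z \<in> {0<..<1} \<Longrightarrow> nc_coeff (G z) u = 0"
  obtains c where "\<And>z. z \<in> {0<..<1} \<Longrightarrow> nc_coeff (G z) w = c"
proof -
  have "((\<lambda>t. nc_coeff (G t) w) has_derivative (\<lambda>h. 0)) (at z within {0<..<1})"
    if "z \<in> {0<..<1}" for z
  proof -
    have "((\<lambda>t. nc_coeff (G t) w) has_vector_derivative 0) (at z)"
    proof (cases w)
      case Nil
      thus ?thesis using kz_solution_Nil [OF assms(1) that] by simp
    next
      case (Cons a u)
      thus ?thesis using kz_solution_Cons [OF assms(1) that, of a u] assms(2) [of u z] that by simp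
    qed
    thus ?thesis by (simp add: has_vector_derivative_def has_derivative_at_withinI)
  qed
  from has_derivative_zero_constant [OF _ this] that show ?thesis
    by (metis convex_real_interval(8))
qed

lemma kz_solution_eq_0I:
  assumes "kz_solution G" "z0 \<in> {0<..<1}" "G z0 = 0" "z \<in> {0<..<1}"
  shows "G z = 0"
proof -
  have "\<forall>z\<in>{0<..<1}. nc_coeff (G z) w = 0" for w
  proof (induction w rule: length_induct)
    case (1 w)
    show ?case by (rule kz_solution_zero_derivative [OF assms(1), of w])
        (use 1 assms in \<open>auto, metis greaterThanLessThan_iff nc_coeff_zero\<close>)
  qed
  thus ?thesis using assms by (auto intro!: ncps_eqI)
qed

text \<open>Once all shorter coefficients vanish, the coefficient of \<open>G z * P z\<close> at
  \<open>w\<close> is the one of \<open>G z\<close>, since \<open>P z\<close> has constant term 1.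
  It does not depend on z, so its limit 0 is its value. The factor \<open>P\<close> stands for the
  normalizing powers at either end point.\<close>

lemma kz_solution_eq_0I_limit:
  assumes "kz_solution G" "\<And>z. nc_coeff (P z) [] = 1"
    and "F \<noteq> bot" "eventually (\<lambda>z. z \<in> {0<..<1}) F"
    and lim: "\<And>w. ((\<lambda>z. nc_coeff (G z * P z) w) \<longlongrightarrow> 0) F"
    and "z \<in> {0<..<1}"
  shows "G z = 0"
proof -
  have "\<forall>z\<in>{0<..<1}. nc_coeff (G z) w = 0" for w
  proof (induction w rule: length_induct)
    case (1 w)
    obtain c where c: "\<And>z. z \<in> {0<..<1} \<Longrightarrow> nc_coeff (G z) w = c"
      using kz_solution_zero_derivative [OF assms(1), of w] 1 by blast
    have "nc_coeff (G z * P z) w = c" if "z \<in> {0<..<1}" for z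
    proof -
      have "nc_coeff (G z * P z) w = (\<Sum>k\<le>length w. if k = length w then c else 0)"
        unfolding nc_coeff_mult
      proof (rule sum.cong)
        fix k assume "k \<in> {..length w}"
        thus "nc_coeff (G z) (take k w) * nc_coeff (P z) (drop k w) = (if k = length w then c else 0)"
          using 1 that c assms(2) by (cases "k = length w") auto
      qed simp
      thus ?thesis by simp
    qed
    hence "((\<lambda>z. nc_coeff (G z * P z) w) \<longlongrightarrow> c) F"
      by (intro tendsto_eventually eventually_mono [OF assms(4)])
    hence "c = 0" using lim assms(3) tendsto_unique by blast
    thus ?case using c by simp
  qed
  thus ?thesis using assms by (auto intro!: ncps_eqI)
qed

section \<open>The regular part of the solution at 0\<close>

text \<open>Coefficientwise in \<open>z\<close>, the equation for \<open>H(z) = G\<^sub>0(z) z\<^bsup>-e\<^sub>0\<^esup> = \<Sum>n. H\<^sub>n z\<^sup>n\<close> reads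
  \<open>n H\<^sub>n = e\<^sub>0 H\<^sub>n - H\<^sub>n e\<^sub>0 + e\<^sub>1 (H\<^sub>0 + \<dots> + H\<^sub>n\<^sub>-\<^sub>1)\<close>.\<close>

function hcoeff :: "letter list \<Rightarrow> nat \<Rightarrow> complex" where
  "hcoeff w n = (if w = [] then if n = 0 then 1 else 0 else if n = 0 then 0 else
     ((if hd w = L0 then hcoeff (tl w) n else 0) - (if last w = L0 then hcoeff (butlast w) n else 0) +
      (if hd w = L1 then \<Sum>k<n. hcoeff (tl w) k else 0)) / of_nat n)"
  by auto
termination by (relation "Wellfounded.measure (length \<circ> fst)") auto

declare hcoeff.simps [simp del]

lemma hcoeff_Nil: "hcoeff [] n = (if n = 0 then 1 else 0)"
  by (simp add: hcoeff.simps)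

lemma hcoeff_0: "hcoeff w 0 = (if w = [] then 1 else 0)"
  by (simp add: hcoeff.simps)

text \<open>The form without division also covers n = 0: there a nonzero term occurs only for
  \<open>[L0]\<close>, where the first two terms are 1 and cancel.\<close>

lemma hcoeff_rec:
  assumes "w \<noteq> []"
  shows "of_nat n * hcoeff w n =
     (if hd w = L0 then hcoeff (tl w) n else 0) - (if last w = L0 then hcoeff (butlast w) n else 0) +
      (if hd w = L1 then \<Sum>k<n. hcoeff (tl w) k else 0)"
proof (cases "n = 0")
  case True
  show ?thesis
  proof (cases w rule: rev_cases)
    case (snoc v b)
    show ?thesis by (cases v) (use True snoc in \<open>auto simp: hcoeff_0\<close>)
  qed (use assms in auto)
next
  case False
  thus ?thesis using assms by (subst hcoeff.simps) simp
qed

section \<open>Growth of the coefficients and convergence in the unit disc\<close>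

lemma sum_inverse_sqrt_le: "(\<Sum>k=1..n. 1 / sqrt (real k)) \<le> 2 * sqrt (real n)"
proof (induction n)
  case (Suc n)
  have "1 / sqrt (real (Suc n)) \<le> 2 * (sqrt (real (Suc n)) - sqrt (real n))"
  proof -
    \<comment> \<open>The inequality of arithmetic and geometric means, which bounds 1 / sqrt (n +
      1) by a telescoping difference.\<close>
    have "2 * sqrt (real (Suc n)) * sqrt (real n) \<le> real (Suc n) + real n"
      using arith_geo_mean_sqrt [of "real (Suc n)" "real n"] by (simp add: real_sqrt_mult)
    hence "1 \<le> 2 * (sqrt (real (Suc n)) - sqrt (real n)) * sqrt (real (Suc n))"
      by (simp add: algebra_simps)
    thus ?thesis by (subst pos_divide_le_eq) auto
  qed
  with Suc show ?case by simp
qed simp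

text \<open>The exponent 1/2 closes the induction: partial sums of terms of size 1 / sqrt k are of
  size sqrt n, and division by n restores 1 / sqrt n. The index 0 is excluded because division by
  \<open>sqrt 0\<close> yields 0, whereas the empty word has coefficient 1 there.\<close>

lemma hcoeff_bound:
  obtains C where "C \<ge> 0" "\<And>n. n \<ge> 1 \<Longrightarrow> norm (hcoeff w n) \<le> C / sqrt n"
proof -
  have "\<exists>C\<ge>0. \<forall>n\<ge>1. norm (hcoeff w n) \<le> C / sqrt n"
  proof (induction w rule: length_induct)
    case (1 w)
    show ?case
    proof (cases "w = []")
      case True
      thus ?thesis by (auto simp: hcoeff_Nil)
    next
      case False
      obtain C where C: "C \<ge> 0" "\<And>n. n \<ge> 1 \<Longrightarrow> norm (hcoeff (tl w) n) \<le> C / sqrt n"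
        using 1 [rule_format, of "tl w"] False by auto
      obtain D where D: "D \<ge> 0" "\<And>n. n \<ge> 1 \<Longrightarrow> norm (hcoeff (butlast w) n) \<le> D / sqrt n"
        using 1 [rule_format, of "butlast w"] False by auto
      \<comment> \<open>C comes from the term with a leading 0, 2 C from the partial sum, D from the
        term with a trailing 0, and 1 from the summand k = 0, to which the induction hypothesis does
        not apply.\<close>
      have "norm (hcoeff w n) \<le> (3 * C + D + 1) / sqrt n" if n: "n \<ge> 1" for n
      proof -
        have sqrt: "1 \<le> sqrt n" "sqrt n * sqrt n = n" using n by auto
        have "norm (\<Sum>k<n. hcoeff (tl w) k) \<le> norm (hcoeff (tl w) 0) + norm (\<Sum>k=1..<n. hcoeff (tl w) k)"
          using n by (simp add: lessThan_atLeast0 sum.atLeast_Suc_lessThan norm_triangle_ineq)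
        also have "norm (hcoeff (tl w) 0) \<le> 1" by (simp add: hcoeff_0)
        also have "norm (\<Sum>k=1..<n. hcoeff (tl w) k) \<le> (\<Sum>k=1..<n. C / sqrt k)"
          by (rule sum_norm_le) (use C in auto)
        also have "\<dots> \<le> (\<Sum>k=1..n. C / sqrt k)"
          by (rule sum_mono2) (use C in auto)
        also have "\<dots> = C * (\<Sum>k=1..n. 1 / sqrt k)" by (simp add: sum_distrib_left)
        also have "\<dots> \<le> C * (2 * sqrt n)" by (intro mult_left_mono sum_inverse_sqrt_le C)
        finally have sum: "norm (\<Sum>k<n. hcoeff (tl w) k) \<le> 1 + C * (2 * sqrt n)" by simp
        have le: "x / sqrt n \<le> x * sqrt n" if "x \<ge> 0" for x
        proof -
          have "x / sqrt n \<le> x / 1" using sqrt that by (intro divide_left_mono) auto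
          also have "x / 1 \<le> x * sqrt n" using mult_left_mono [OF sqrt(1) that] by simp
          finally show ?thesis .
        qed
        have "real n * norm (hcoeff w n) = norm (of_nat n * hcoeff w n)" by (simp add: norm_mult)
        also have "\<dots> \<le> C / sqrt n + D / sqrt n + (1 + C * (2 * sqrt n))"
          unfolding hcoeff_rec [OF False]
        proof (intro order.trans [OF norm_triangle_ineq] order.trans [OF norm_triangle_ineq4] add_mono)
          show "norm (if hd w = L0 then hcoeff (tl w) n else 0) \<le> C / sqrt n"
            using C n by auto
          show "norm (if last w = L0 then hcoeff (butlast w) n else 0) \<le> D / sqrt n"
            using D n by auto
          show "norm (if hd w = L1 then \<Sum>k<n. hcoeff (tl w) k else 0) \<le> 1 + C * (2 * sqrt n)"
            using sum C n by auto
        qed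
        also have "\<dots> \<le> C * sqrt n + D * sqrt n + (sqrt n + C * (2 * sqrt n))"
          by (intro add_mono le) (use C D sqrt in auto)
        also have "\<dots> = (3 * C + D + 1) * sqrt n" by (simp add: algebra_simps)
        finally have "sqrt n * (sqrt n * norm (hcoeff w n)) \<le> sqrt n * (3 * C + D + 1)"
          using sqrt(2) by (simp add: mult_ac flip: mult.assoc)
        hence "sqrt n * norm (hcoeff w n) \<le> 3 * C + D + 1" using sqrt(1) by simp
        thus ?thesis using sqrt(1) by (simp add: field_simps)
      qed
      moreover have "3 * C + D + 1 \<ge> 0" using C D by simp
      ultimately show ?thesis by blast
    qed
  qed
  thus ?thesis using that by blast
qed

lemma summable_hcoeff:
  fixes z :: complex
  assumes "norm z < 1"
  shows "summable (\<lambda>n. norm (hcoeff w n * z ^ n))"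
proof -
  obtain C where C: "C \<ge> 0" "\<And>n. n \<ge> 1 \<Longrightarrow> norm (hcoeff w n) \<le> C / sqrt n"
    using hcoeff_bound by blast
  have "norm (hcoeff w n) \<le> C + 1" for n
  proof (cases "n = 0")
    case False
    hence "C / sqrt n \<le> C / 1" using C by (intro divide_left_mono) auto
    thus ?thesis using C(2) [of n] False by simp
  qed (use C in \<open>auto simp: hcoeff_0\<close>)
  hence le: "norm (norm (hcoeff w n * z ^ n)) \<le> (C + 1) * norm z ^ n" for n
    by (simp add: norm_mult norm_power mult_right_mono)
  have "summable (\<lambda>n. (C + 1) * norm z ^ n)"
    using assms by (simp add: summable_mult summable_geometric)
  thus ?thesis by (rule summable_comparison_test' [where N = 0]) (rule le)
qed

definition hseries :: "real \<Rightarrow> ncps" where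
  "hseries z = Ncps (\<lambda>w. \<Sum>n. hcoeff w n * of_real z ^ n)"

lemma hseries_sums:
  assumes "\<bar>z\<bar> < 1"
  shows "(\<lambda>n. hcoeff w n * of_real z ^ n) sums nc_coeff (hseries z) w"
  using summable_sums [OF summable_norm_cancel [OF summable_hcoeff [of "of_real z"]]] assms
  by (simp add: hseries_def)

text \<open>Multiplication by the geometric series forms partial sums, and the extra factor z makes
  them strict. Thus the form dz/(1-z) accounts for the sum over k < n in the recursion.\<close>

lemma hseries_partial_sums:
  assumes "\<bar>z\<bar> < 1"
  shows "(\<lambda>n. (\<Sum>k<n. hcoeff w k) * of_real z ^ n) sums (of_real (z / (1 - z)) * nc_coeff (hseries z) w)"
proof -
  let ?z = "complex_of_real z"
  have "(\<lambda>k. \<Sum>i\<le>k. hcoeff w i * ?z ^ i * ?z ^ (k - i)) sums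
      ((\<Sum>n. hcoeff w n * ?z ^ n) * (\<Sum>n. ?z ^ n))"
    by (rule Cauchy_product_sums)
      (use assms summable_hcoeff [of ?z w] in \<open>auto simp: norm_power intro: summable_geometric\<close>)
  also have "(\<Sum>n. ?z ^ n) = 1 / (1 - ?z)" using assms by (intro suminf_geometric) simp
  also have "(\<lambda>k. \<Sum>i\<le>k. hcoeff w i * ?z ^ i * ?z ^ (k - i)) =
      (\<lambda>k. (\<Sum>i<Suc k. hcoeff w i) * ?z ^ k)"
    unfolding sum_distrib_right lessThan_Suc_atMost
    by (auto simp: mult.assoc simp flip: power_add intro!: ext sum.cong)
  finally have "(\<lambda>k. ?z * ((\<Sum>i<Suc k. hcoeff w i) * ?z ^ k)) sums
      (?z * ((\<Sum>n. hcoeff w n * ?z ^ n) * (1 / (1 - ?z))))"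
    by (rule sums_mult)
  hence "(\<lambda>k. (\<Sum>i<Suc k. hcoeff w i) * ?z ^ Suc k) sums
      (?z * ((\<Sum>n. hcoeff w n * ?z ^ n) * (1 / (1 - ?z))))"
    by (simp only: power_Suc mult_ac)
  thus ?thesis
    unfolding sums_Suc_iff [of "\<lambda>k. (\<Sum>i<k. hcoeff w i) * ?z ^ k"]
    by (simp add: hseries_def mult_ac)
qed

lemma nc_coeff_mult_var:
  assumes "w \<noteq> []"
  shows "nc_coeff (f * nc_var a) w = (if a = last w then nc_coeff f (butlast w) else 0)"
  using nc_coeff_mult_var_snoc [of f a "butlast w" "last w"] assms by simp

lemma nc_coeff_var_mult:
  assumes "w \<noteq> []"
  shows "nc_coeff (nc_var a * f) w = (if a = hd w then nc_coeff f (tl w) else 0)"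
  using assms by (cases w) auto

text \<open>The equation is singular at 0, so the derivative there is read off the power series.
  Elsewhere z times the derivative has the coefficients \<open>of_nat n * hcoeff w n\<close>, which
  are the left side of \<open>hcoeff_rec\<close>.\<close>

lemma hseries_deriv_0: "((\<lambda>t. nc_coeff (hseries t) w) has_vector_derivative hcoeff w 1) (at 0)"
  and hseries_deriv:
  "\<lbrakk>\<bar>z\<bar> < 1; z \<noteq> 0\<rbrakk> \<Longrightarrow> nc_has_deriv hseries (nc_smult (of_real (1 / z)) (e0 * hseries z - hseries z * e0) +
     nc_smult (of_real (1 / (1 - z))) (e1 * hseries z)) z"
proof -
  have deriv: "((\<lambda>t. nc_coeff (hseries t) w) has_vector_derivative
      (\<Sum>n. diffs (hcoeff w) n * of_real z ^ n)) (at z)"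
    if "\<bar>z\<bar> < 1" for z w
    unfolding hseries_def nc_coeff_Ncps
    by (rule has_vector_derivative_real_field, rule termdiffs_strong' [where K = 1])
      (use that in \<open>auto intro: summable_norm_cancel summable_hcoeff\<close>)
  from deriv [of 0 w]
  show "((\<lambda>t. nc_coeff (hseries t) w) has_vector_derivative hcoeff w 1) (at 0)"
    by (simp add: diffs_def)
  assume z: "\<bar>z\<bar> < 1" "z \<noteq> 0"
  show "nc_has_deriv hseries (nc_smult (of_real (1 / z)) (e0 * hseries z - hseries z * e0) +
     nc_smult (of_real (1 / (1 - z))) (e1 * hseries z)) z"
    unfolding nc_has_deriv_def
  proof
    fix w
    let ?z = "complex_of_real z" and ?d = "\<Sum>n. diffs (hcoeff w) n * of_real z ^ n"
    have "summable (\<lambda>n. diffs (hcoeff w) n * ?z ^ n)"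
      by (rule termdiff_converges [where K = 1])
        (use z in \<open>auto intro: summable_norm_cancel summable_hcoeff\<close>)
    hence "(\<lambda>n. ?z * (diffs (hcoeff w) n * ?z ^ n)) sums (?z * ?d)"
      by (intro sums_mult summable_sums)
    hence "(\<lambda>n. of_nat (Suc n) * hcoeff w (Suc n) * ?z ^ Suc n) sums (?z * ?d)"
      by (simp only: power_Suc mult_ac diffs_def)
    hence zd: "(\<lambda>n. of_nat n * hcoeff w n * ?z ^ n) sums (?z * ?d)"
      unfolding sums_Suc_iff [of "\<lambda>n. of_nat n * hcoeff w n * ?z ^ n"] by simp
    let ?R = "nc_coeff (e0 * hseries z - hseries z * e0 +
        nc_smult (of_real (z / (1 - z))) (e1 * hseries z)) w"
    have "(\<lambda>n. of_nat n * hcoeff w n * ?z ^ n) sums ?R"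
    proof (cases "w = []")
      case True
      have "(\<lambda>n. of_nat n * hcoeff [] n * ?z ^ n) = (\<lambda>n. 0)" by (auto simp: hcoeff_Nil)
      thus ?thesis using True by simp
    next
      case False
      have if_mult: "(if P then x else 0) * y = (if P then x * y else 0)" for P and x y :: complex
        by simp
      have sums_if: "(\<lambda>n. if P then f n else 0) sums (if P then x else 0)" if "f sums x"
        for P x and f :: "nat \<Rightarrow> complex" using that by simp
      show ?thesis
        unfolding hcoeff_rec [OF False] nc_coeff_add nc_coeff_diff nc_coeff_smult
          nc_coeff_var_mult [OF False] nc_coeff_mult_var [OF False] distrib_right left_diff_distrib
          if_mult eq_commute [of L0] eq_commute [of L1]
        using sums_if [OF hseries_partial_sums [OF z(1), of "tl w"], of "hd w = L1"]
        by (intro sums_add sums_diff sums_if hseries_sums z) (simp cong: if_cong add: if_distrib)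
    qed
    hence "?z * ?d = ?R" using zd sums_unique2 by blast
    hence "?d = ?R / ?z" using z by (simp add: field_simps)
    also have "\<dots> = nc_coeff (nc_smult (of_real (1 / z)) (e0 * hseries z - hseries z * e0) +
       nc_smult (of_real (1 / (1 - z))) (e1 * hseries z)) w"
      using z by (simp add: add_divide_distrib)
    finally show "((\<lambda>t. nc_coeff (hseries t) w) has_vector_derivative
      nc_coeff (nc_smult (of_real (1 / z)) (e0 * hseries z - hseries z * e0) +
       nc_smult (of_real (1 / (1 - z))) (e1 * hseries z)) w) (at z)"
      using deriv [OF z(1), of w] by simp
  qed
qed

lemma nc_coeff_hseries_Nil [simp]: "nc_coeff (hseries z) [] = 1"
proof -
  have "(\<lambda>n. hcoeff [] n * complex_of_real z ^ n) = (\<lambda>n. if n = 0 then 1 else 0)"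
    by (auto simp: hcoeff_Nil)
  thus ?thesis
    using sums_unique [OF sums_single [of 0 "\<lambda>_. 1 :: complex"]] by (simp add: hseries_def)
qed

lemma hseries_0: "hseries 0 = 1"
  by (rule ncps_eqI) (simp add: hseries_def hcoeff_0 nc_coeff_one)

lemma hseries_tendsto_0: "((\<lambda>z. nc_coeff (hseries z) w) \<longlongrightarrow> nc_coeff 1 w) (at_right 0)"
proof -
  have "isCont (\<lambda>z. nc_coeff (hseries z) w) 0"
    using hseries_deriv_0 has_vector_derivative_continuous by blast
  thus ?thesis unfolding isCont_def by (metis hseries_0 at_le subset_UNIV tendsto_mono)
qed

section \<open>The canonical solutions\<close>

lemma nc_powr_deriv:
  assumes "z > 0"
  shows "nc_has_deriv (\<lambda>z. nc_powr z 1 a) (nc_smult (of_real (1 / z)) (nc_var a * nc_powr z 1 a)) z"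
  unfolding nc_has_deriv_def
proof
  fix w
  show "((\<lambda>z. nc_coeff (nc_powr z 1 a) w) has_vector_derivative
      nc_coeff (nc_smult (of_real (1 / z)) (nc_var a * nc_powr z 1 a)) w) (at z)"
  proof (cases w)
    case (Cons b u)
    show ?thesis
    proof (cases "w = replicate (length w) a")
      case True
      let ?n = "length u"
      have "((\<lambda>z. ln z ^ Suc ?n) has_real_derivative real (Suc ?n) * (1 / z * ln z ^ ?n)) (at z)"
        by (rule derivative_eq_intros refl assms)+ simp
      from DERIV_cdivide [OF this, of "fact (Suc ?n)"]
      have "((\<lambda>z. ln z ^ Suc ?n / fact (Suc ?n)) has_real_derivative 1 / z * (ln z ^ ?n / fact ?n)) (at z)"
        by (simp del: of_nat_Suc)
      hence "((\<lambda>z. complex_of_real (ln z ^ Suc ?n / fact (Suc ?n))) has_vector_derivative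
          of_real (1 / z * (ln z ^ ?n / fact ?n))) (at z)"
        by (rule has_vector_derivative_of_real)
      with True Cons show ?thesis
        by (simp add: nc_powr_def nc_coeff_letter_series)
    qed (use Cons in \<open>auto simp: nc_powr_def nc_coeff_letter_series\<close>)
  qed simp
qed

text \<open>The term -H e_0 / z in the derivative of H cancels against the derivative of the power
  of z.\<close>

lemma kz_solution_hseries: "kz_solution (\<lambda>z. hseries z * nc_powr z 1 L0)"
  unfolding kz_solution_iff
proof
  fix z :: real assume z: "z \<in> {0<..<1}"
  let ?H = "hseries z" and ?P = "nc_powr z 1 L0"
  have "nc_has_deriv (\<lambda>z. hseries z * nc_powr z 1 L0)
      ((nc_smult (of_real (1 / z)) (e0 * ?H - ?H * e0) + nc_smult (of_real (1 / (1 - z))) (e1 * ?H)) * ?P +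
       ?H * nc_smult (of_real (1 / z)) (e0 * ?P)) z"
    by (intro nc_has_deriv_mult hseries_deriv nc_powr_deriv) (use z in auto)
  also have "(nc_smult (of_real (1 / z)) (e0 * ?H - ?H * e0) + nc_smult (of_real (1 / (1 - z))) (e1 * ?H)) * ?P +
       ?H * nc_smult (of_real (1 / z)) (e0 * ?P) = kz_field z * (?H * ?P)" (is "?l = ?r")
  proof -
    have "?l = nc_smult (of_real (1 / z)) (e0 * ?H * ?P - ?H * e0 * ?P) +
        nc_smult (of_real (1 / (1 - z))) (e1 * ?H * ?P) + nc_smult (of_real (1 / z)) (?H * e0 * ?P)"
      by (simp only: distrib_right left_diff_distrib nc_smult_mult_left nc_smult_mult_right mult.assoc)
    also have "\<dots> = nc_smult (of_real (1 / z)) (e0 * ?H * ?P) + nc_smult (of_real (1 / (1 - z))) (e1 * ?H * ?P)"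
      by (rule ncps_eqI) (simp add: algebra_simps)
    also have "\<dots> = ?r" by (simp add: kz_field_def distrib_right nc_smult_mult_left mult.assoc)
    finally show ?thesis .
  qed
  finally show "nc_has_deriv (\<lambda>z. hseries z * nc_powr z 1 L0) (kz_field z * (?H * ?P)) z" .
qed

text \<open>The explicit series gives existence; uniqueness follows because the difference of two
  candidates, multiplied by the normalizing power, tends to 0.\<close>

lemma G0_eq: "G0 = (\<lambda>z. if z \<in> {0<..<1} then hseries z * nc_powr z 1 L0 else 0)"
  unfolding G0_def
proof (rule the_equality)
  let ?G = "\<lambda>z. if z \<in> {0<..<1::real} then hseries z * nc_powr z 1 L0 else 0"
  have ev: "\<forall>\<^sub>F z in at_right 0. z \<in> {0<..<1::real}"
    using eventually_at_right_real [of 0 "1::real"] by simp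
  have kz: "kz_solution ?G" by (rule kz_solution_cong [OF kz_solution_hseries]) auto
  have lim: "((\<lambda>z. nc_coeff (?G z * nc_powr z (-1) L0) w) \<longlongrightarrow> nc_coeff 1 w) (at_right 0)" for w
  proof (rule Lim_transform_eventually [OF hseries_tendsto_0 [of w] eventually_mono [OF ev]])
    fix z :: real assume "z \<in> {0<..<1}"
    thus "nc_coeff (hseries z) w = nc_coeff (?G z * nc_powr z (-1) L0) w"
      by (simp add: mult.assoc nc_powr_mult)
  qed
  show "kz_solution ?G \<and> (\<forall>z. z \<notin> {0<..<1} \<longrightarrow> ?G z = 0) \<and>
      (\<forall>w. ((\<lambda>z. nc_coeff (?G z * nc_powr z (-1) L0) w) \<longlongrightarrow> nc_coeff 1 w) (at_right 0))"
    using kz lim by auto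
  fix G assume G: "kz_solution G \<and> (\<forall>z. z \<notin> {0<..<1} \<longrightarrow> G z = 0) \<and>
      (\<forall>w. ((\<lambda>z. nc_coeff (G z * nc_powr z (-1) L0) w) \<longlongrightarrow> nc_coeff 1 w) (at_right 0))"
  show "G = ?G"
  proof
    fix z
    show "G z = ?G z"
    proof (cases "z \<in> {0<..<1}")
      case True
      have "G z - ?G z = 0"
      proof (rule kz_solution_eq_0I_limit [OF kz_solution_diff [OF _ kz] _ _ ev _ True,
            where P = "\<lambda>z. nc_powr z (-1) L0"])
        fix w
        show "((\<lambda>z. nc_coeff ((G z - ?G z) * nc_powr z (- 1) L0) w) \<longlongrightarrow> 0) (at_right 0)"
          using tendsto_diff [OF G [THEN conjunct2, THEN conjunct2, rule_format, of w] lim [of w]]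
          by (simp add: left_diff_distrib)
      qed (use G kz in auto)
      thus ?thesis by simp
    qed (use G in auto)
  qed
qed

lemma kz_solution_G0: "kz_solution G0"
  unfolding G0_eq by (rule kz_solution_cong [OF kz_solution_hseries]) auto

lemma kz_solution_swap:
  assumes "kz_solution G"
  shows "kz_solution (\<lambda>z. nc_swap (G (1 - z)))"
  unfolding kz_solution_iff nc_has_deriv_def
proof (intro ballI allI)
  fix z :: real and w assume z: "z \<in> {0<..<1}"
  hence z': "1 - z \<in> {0<..<1}" by auto
  have comp: "((\<lambda>t. c * f (1 - t)) has_vector_derivative - c * d) (at z)"
    if "(f has_vector_derivative d) (at (1 - z))" for f and c d :: complex
  proof -
    have "((\<lambda>t. 1 - t) has_real_derivative -1) (at z)" by (auto intro!: derivative_eq_intros)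
    from vector_diff_chain_at [OF this [unfolded has_real_derivative_iff_has_vector_derivative]] that
    have "((f \<circ> (\<lambda>t. 1 - t)) has_vector_derivative - d) (at z)" by fastforce
    from has_vector_derivative_mult_right [OF this, of c] show ?thesis by (simp add: o_def)
  qed
  show "((\<lambda>t. nc_coeff (nc_swap (G (1 - t))) w) has_vector_derivative
      nc_coeff (kz_field z * nc_swap (G (1 - z))) w) (at z)"
  proof (cases w)
    case Nil
    show ?thesis using comp [OF kz_solution_Nil [OF assms z'], of 1] Nil by simp
  next
    case (Cons a u)
    \<comment> \<open>Reflection exchanges the two forms. The minus sign of the chain rule is the
      sign by which \<open>nc_swap\<close> treats \<open>a # u\<close> differently from
      \<open>u\<close>.\<close>
    have "kz_form (swap_letter a) (1 - z) = kz_form a z" by (cases a) (auto simp: kz_form_def)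
    thus ?thesis using comp [OF kz_solution_Cons [OF assms z', of "swap_letter a" "map swap_letter u"],
          of "(-1) ^ length w"] Cons by (simp add: mult_ac)
  qed
qed

lemma filterlim_one_minus: "filterlim (\<lambda>z::real. 1 - z) (at_right 0) (at_left 1)"
  "filterlim (\<lambda>z::real. 1 - z) (at_left 1) (at_right 0)"
  by real_asymp+

lemma G1_eq: "G1 = (\<lambda>z. nc_swap (G0 (1 - z)))"
  unfolding G1_def
proof (rule the_equality)
  let ?G = "\<lambda>z. nc_swap (G0 (1 - z))"
  have ev: "\<forall>\<^sub>F z in at_left 1. z \<in> {0<..<1::real}"
    using eventually_at_left_real [of 0 "1::real"] by simp
  have kz: "kz_solution ?G" by (rule kz_solution_swap [OF kz_solution_G0])
  have lim: "((\<lambda>z. nc_coeff (?G z * nc_powr (1 - z) 1 L1) w) \<longlongrightarrow> nc_coeff 1 w) (at_left 1)" for w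
  proof -
    let ?v = "map swap_letter w"
    have "((\<lambda>z. nc_coeff (nc_swap (hseries z)) w) \<longlongrightarrow> nc_coeff (nc_swap 1) w) (at_right 0)"
      unfolding nc_coeff_swap by (intro tendsto_mult_left hseries_tendsto_0)
    from filterlim_compose [OF this filterlim_one_minus(1)]
    have "((\<lambda>z. nc_coeff (nc_swap (hseries (1 - z))) w) \<longlongrightarrow> nc_coeff 1 w) (at_left 1)" by simp
    thus ?thesis
    proof (rule Lim_transform_eventually [OF _ eventually_mono [OF ev]])
      fix z :: real assume z: "z \<in> {0<..<1}"
      \<comment> \<open>The swap negates the exponent, so the logarithms at 1 cancel exactly as
        those of \<open>G0\<close> do at 0.\<close>
      have "nc_swap (nc_powr (1 - z) 1 L0) * nc_powr (1 - z) 1 L1 = 1"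
        by (simp add: nc_swap_powr nc_powr_mult)
      thus "nc_coeff (nc_swap (hseries (1 - z))) w = nc_coeff (?G z * nc_powr (1 - z) 1 L1) w"
        using z by (simp add: G0_eq nc_swap_mult mult.assoc)
    qed
  qed
  show "kz_solution ?G \<and> (\<forall>z. z \<notin> {0<..<1} \<longrightarrow> ?G z = 0) \<and>
      (\<forall>w. ((\<lambda>z. nc_coeff (?G z * nc_powr (1 - z) 1 L1) w) \<longlongrightarrow> nc_coeff 1 w) (at_left 1))"
    using kz lim by (auto simp: G0_eq)
  fix G assume G: "kz_solution G \<and> (\<forall>z. z \<notin> {0<..<1} \<longrightarrow> G z = 0) \<and>
      (\<forall>w. ((\<lambda>z. nc_coeff (G z * nc_powr (1 - z) 1 L1) w) \<longlongrightarrow> nc_coeff 1 w) (at_left 1))"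
  show "G = ?G"
  proof
    fix z
    show "G z = ?G z"
    proof (cases "z \<in> {0<..<1}")
      case True
      have "G z - ?G z = 0"
      proof (rule kz_solution_eq_0I_limit [OF kz_solution_diff [OF _ kz] _ _ ev _ True,
            where P = "\<lambda>z. nc_powr (1 - z) 1 L1"])
        fix w
        show "((\<lambda>z. nc_coeff ((G z - ?G z) * nc_powr (1 - z) 1 L1) w) \<longlongrightarrow> 0) (at_left 1)"
          using tendsto_diff [OF G [THEN conjunct2, THEN conjunct2, rule_format, of w] lim [of w]]
          by (simp add: left_diff_distrib)
      qed (use G kz in auto)
      thus ?thesis by simp
    qed (use G in \<open>auto simp: G0_eq\<close>)
  qed
qed

lemma kz_solution_G1: "kz_solution G1"
  unfolding G1_eq by (rule kz_solution_swap [OF kz_solution_G0])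

lemma nc_coeff_G0_Nil:
  assumes "z \<in> {0<..<1}"
  shows "nc_coeff (G0 z) [] = 1"
  using assms by (simp add: G0_eq)

lemma nc_coeff_G1_Nil:
  assumes "z \<in> {0<..<1}"
  shows "nc_coeff (G1 z) [] = 1"
  using assms by (simp add: G1_eq nc_coeff_G0_Nil)

section \<open>Boundary behaviour and the associator\<close>

text \<open>Split the word between H and the power of z. With an empty prefix the suffix begins with
  \<open>L1\<close>, and the power of \<open>e0\<close> has coefficient 0 there; with a nonempty
  prefix the coefficient of H is O(z), which beats every power of the logarithm.\<close>

lemma G0_tendsto_0: "((\<lambda>z. nc_coeff (G0 z) (L1 # v)) \<longlongrightarrow> 0) (at_right 0)"
proof -
  let ?w = "L1 # v"
  have lim: "((\<lambda>z. nc_coeff (hseries z) u * of_real (ln z ^ n)) \<longlongrightarrow> 0) (at_right 0)" if "u \<noteq> []" for u n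
  proof -
    have "((\<lambda>z. norm (nc_coeff (hseries z) u - z *\<^sub>R hcoeff u 1) / norm z) \<longlongrightarrow> 0) (at 0)"
      using hseries_deriv_0 [of u] that
      by (simp add: has_vector_derivative_def has_derivative_at hseries_0 nc_coeff_one)
    hence "((\<lambda>z. norm (nc_coeff (hseries z) u - z *\<^sub>R hcoeff u 1) / norm z) \<longlongrightarrow> 0) (at_right 0)"
      by (rule tendsto_mono [OF at_le [OF subset_UNIV]])
    hence "((\<lambda>z. norm (nc_coeff (hseries z) u /\<^sub>R z - hcoeff u 1)) \<longlongrightarrow> 0) (at_right 0)"
    proof (rule Lim_transform_eventually [OF _ eventually_mono [OF eventually_at_right_less]])
      fix z :: real assume "0 < z"
      hence "nc_coeff (hseries z) u /\<^sub>R z - hcoeff u 1 =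
          (nc_coeff (hseries z) u - z *\<^sub>R hcoeff u 1) /\<^sub>R z"
        by (simp add: scaleR_right_diff_distrib)
      thus "norm (nc_coeff (hseries z) u - z *\<^sub>R hcoeff u 1) / norm z =
          norm (nc_coeff (hseries z) u /\<^sub>R z - hcoeff u 1)"
        by (simp add: divide_inverse_commute)
    qed
    hence "((\<lambda>z. nc_coeff (hseries z) u /\<^sub>R z) \<longlongrightarrow> hcoeff u 1) (at_right 0)"
      by (rule LIM_zero_cancel [OF tendsto_norm_zero_cancel])
    moreover have "((\<lambda>z::real. z * ln z ^ n) \<longlongrightarrow> 0) (at_right 0)" by real_asymp
    ultimately have "((\<lambda>z. (nc_coeff (hseries z) u /\<^sub>R z) * of_real (z * ln z ^ n)) \<longlongrightarrow>
        hcoeff u 1 * of_real 0) (at_right 0)"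
      by (intro tendsto_mult tendsto_of_real)
    hence "((\<lambda>z. (nc_coeff (hseries z) u /\<^sub>R z) * of_real (z * ln z ^ n)) \<longlongrightarrow> 0) (at_right 0)"
      by simp
    thus ?thesis
      by (rule Lim_transform_eventually [OF _ eventually_mono [OF eventually_at_right_less]])
        (simp add: scaleR_conv_of_real)
  qed
  have "((\<lambda>z. \<Sum>k\<le>length ?w. nc_coeff (hseries z) (take k ?w) * nc_coeff (nc_powr z 1 L0) (drop k ?w))
      \<longlongrightarrow> (\<Sum>k\<le>length ?w. 0)) (at_right 0)"
  proof (rule tendsto_sum)
    fix k
    let ?d = "drop k ?w"
    show "((\<lambda>z. nc_coeff (hseries z) (take k ?w) * nc_coeff (nc_powr z 1 L0) ?d) \<longlongrightarrow> 0) (at_right 0)"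
    proof (cases "k = 0 \<or> ?d \<noteq> replicate (length ?d) L0")
      case True
      hence "nc_coeff (nc_powr z 1 L0) ?d = 0" for z
        by (cases k) (auto simp: nc_powr_def nc_coeff_letter_series)
      thus ?thesis by simp
    next
      case False
      hence "take k ?w \<noteq> []" by (cases k) auto
      from tendsto_divide [OF lim [OF this, of "length ?d"] tendsto_const [of "fact (length ?d)"]] False
      show ?thesis by (simp add: nc_powr_def nc_coeff_letter_series)
    qed
  qed
  hence "((\<lambda>z. nc_coeff (hseries z * nc_powr z 1 L0) ?w) \<longlongrightarrow> 0) (at_right 0)"
    by (simp only: nc_coeff_mult sum.neutral_const)
  thus ?thesis
  proof (rule Lim_transform_eventually [OF _ eventually_mono])
    show "\<forall>\<^sub>F z in at_right 0. z \<in> {0<..<1::real}"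
      using eventually_at_right_real [of 0 "1::real"] by simp
  qed (simp add: G0_eq)
qed

lemma G1_tendsto_1: "((\<lambda>z. nc_coeff (G1 z) (L0 # v)) \<longlongrightarrow> 0) (at_left 1)"
  using tendsto_mult_left [OF filterlim_compose [OF G0_tendsto_0 filterlim_one_minus(1)], of "(-1) ^ length (L0 # v)"]
  by (simp add: G1_eq)

lemma associator:
  assumes "z \<in> {0<..<1}"
  shows "G1 z * associator = G0 z"
proof -
  \<comment> \<open>The base point 1/2 fixes the constant; \<open>G1 z * A\<close> and
    \<open>G0 z\<close> solve the same equation and agree there, hence everywhere.\<close>
  define A where "A = nc_inv (G1 (1 / 2)) * G0 (1 / 2)"
  have A: "G1 z * A = G0 z" if z: "z \<in> {0<..<1}" for z
  proof -
    have kz: "kz_solution (\<lambda>z. G1 z * A - G0 z)"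
      by (intro kz_solution_diff kz_solution_mult_const kz_solution_G0 kz_solution_G1)
    have "G1 (1 / 2) * A - G0 (1 / 2) = 0"
      by (simp add: A_def mult.assoc [symmetric] nc_mult_inv nc_coeff_G1_Nil)
    with kz_solution_eq_0I [OF kz, of "1 / 2" z] z show ?thesis by simp
  qed
  have "associator = A" unfolding associator_def
  proof (rule the_equality)
    show "\<forall>z\<in>{0<..<1}. A = nc_inv (G1 z) * G0 z"
      by (simp flip: A add: mult.assoc [symmetric] nc_inv_mult nc_coeff_G1_Nil)
    show "C = A" if "\<forall>z\<in>{0<..<1}. C = nc_inv (G1 z) * G0 z" for C
      using that [rule_format, of "1 / 2"] by (simp add: A_def)
  qed
  with A assms show ?thesis by simp
qed

lemma nc_coeff_associator_Nil: "nc_coeff associator [] = 1"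
  using arg_cong [OF associator [of "1 / 2"], of "\<lambda>f. nc_coeff f []"]
  by (simp add: nc_coeff_G0_Nil nc_coeff_G1_Nil)

lemma G1_eq_mult_inv_associator:
  assumes "z \<in> {0<..<1}"
  shows "G1 z = G0 z * nc_inv associator"
  using associator [OF assms]
  by (metis mult.assoc mult.right_neutral nc_mult_inv nc_coeff_associator_Nil)

text \<open>Every nonempty prefix of \<open>L1 # u\<close> begins with \<open>L1\<close>, so
  \<open>G0_tendsto_0\<close> removes all splittings but the one with empty prefix, and no logarithm
  survives.\<close>

lemma G1_tendsto_0:
  "((\<lambda>z. nc_coeff (G1 z) (L1 # u)) \<longlongrightarrow> nc_coeff (nc_inv associator) (L1 # u)) (at_right 0)"
proof -
  let ?w = "L1 # u" and ?B = "nc_inv associator"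
  have ev: "\<forall>\<^sub>F z in at_right 0. z \<in> {0<..<1::real}"
    using eventually_at_right_real [of 0 "1::real"] by simp
  have "((\<lambda>z. \<Sum>k\<le>length ?w. nc_coeff (G0 z) (take k ?w) * nc_coeff ?B (drop k ?w)) \<longlongrightarrow>
      (\<Sum>k\<le>length ?w. if k = 0 then nc_coeff ?B ?w else 0)) (at_right 0)"
  proof (rule tendsto_sum)
    fix k
    show "((\<lambda>z. nc_coeff (G0 z) (take k ?w) * nc_coeff ?B (drop k ?w)) \<longlongrightarrow>
      (if k = 0 then nc_coeff ?B ?w else 0)) (at_right 0)"
    proof (cases k)
      case 0
      thus ?thesis
        by (intro tendsto_eventually eventually_mono [OF ev]) (simp add: nc_coeff_G0_Nil)
    next
      case (Suc j)
      thus ?thesis using tendsto_mult_right [OF G0_tendsto_0 [of "take j u"]] by fastforce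
    qed
  qed
  hence "((\<lambda>z. nc_coeff (G0 z * ?B) ?w) \<longlongrightarrow> nc_coeff ?B ?w) (at_right 0)"
    by (simp add: nc_coeff_mult)
  thus ?thesis
    by (rule Lim_transform_eventually [OF _ eventually_mono [OF ev]])
      (simp add: G1_eq_mult_inv_associator)
qed

section \<open>Multiple zeta values\<close>

text \<open>Indices are read in the opposite order of the multiple zeta values: the first index
  belongs to the largest summation variable.\<close>

fun index_word :: "nat list \<Rightarrow> letter list" where
  "index_word [] = []"
| "index_word (k # ks) = replicate (k - 1) L0 @ L1 # index_word ks"

lemma last_index_word: "index_word ks = [] \<or> last (index_word ks) = L1"
  by (induction ks) auto

text \<open>Read from the right, a letter \<open>L1\<close> opens a new index 1 and a letter
  \<open>L0\<close> increases the current first index, which exists because the word ends in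
  \<open>L1\<close>.\<close>

lemma ex_index_word:
  assumes "w = [] \<or> last w = L1"
  shows "\<exists>ks. (\<forall>k\<in>set ks. k \<ge> 1) \<and> w = index_word ks"
  using assms
proof (induction w)
  case Nil
  show ?case by (rule exI [of _ "[]"]) simp
next
  case (Cons a u)
  then obtain ks where ks: "\<forall>k\<in>set ks. k \<ge> 1" "u = index_word ks" by (auto split: if_splits)
  show ?case
  proof (cases a)
    case L1
    thus ?thesis using ks by (intro exI [of _ "1 # ks"]) auto
  next
    case L0
    hence "ks \<noteq> []" using Cons.prems ks by auto
    then obtain k ks' where "ks = k # ks'" by (cases ks) auto
    thus ?thesis using ks L0 by (intro exI [of _ "Suc k # ks'"]) (cases k; auto)
  qed
qed

section \<open>Coefficients on words ending in 1 as nested sums\<close>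

lemma hcoeff_L0:
  assumes "u \<noteq> []" "last u = L1"
  shows "of_nat n * hcoeff (L0 # u) n = hcoeff u n"
  using hcoeff_rec [of "L0 # u" n] assms by simp

text \<open>On words ending in 1 the subtracted term of the recursion is absent. Then
  \<open>L1\<close> yields a partial sum over n, and each of the j zeros one more division by
  n.\<close>

lemma hcoeff_index_block:
  assumes "u = [] \<or> last u = L1"
  shows "hcoeff (replicate j L0 @ L1 # u) n = (\<Sum>m<n. hcoeff u m) / of_nat n ^ Suc j"
proof (cases "n = 0")
  case False
  show ?thesis
  proof (induction j)
    case 0
    show ?case using hcoeff_rec [of "L1 # u" n] assms False by (cases "u = []") (auto simp: field_simps)
  next
    case (Suc j)
    have "of_nat n * hcoeff (replicate (Suc j) L0 @ L1 # u) n = hcoeff (replicate j L0 @ L1 # u) n"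
      using hcoeff_L0 [of "replicate j L0 @ L1 # u" n] assms by (auto split: if_splits)
    thus ?case using Suc False by (simp add: field_simps)
  qed
qed (simp add: hcoeff_0)

text \<open>The sentinel 0 forces the entries to be positive and gives the empty list the head 0, in
  accordance with \<open>hcoeff_Nil\<close>.\<close>

definition decreasing_lists :: "nat \<Rightarrow> nat \<Rightarrow> nat list set" where
  "decreasing_lists d n = {ms. length ms = d \<and> sorted_wrt (>) (ms @ [0]) \<and> hd (ms @ [0]) = n}"

lemma decreasing_lists_0: "decreasing_lists 0 n = (if n = 0 then {[]} else {})"
  by (auto simp: decreasing_lists_def)

lemma sorted_wrt_greater_Cons_iff:
  fixes xs :: "nat list"
  assumes "xs \<noteq> []"
  shows "sorted_wrt (>) (n # xs) \<longleftrightarrow> hd xs < n \<and> sorted_wrt (>) xs"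
  using assms by (cases xs) (auto intro: less_trans)

text \<open>The counterpart of the strict partial sums: m is the second largest entry, or the
  sentinel.\<close>

lemma decreasing_lists_Suc:
  "decreasing_lists (Suc d) n = (\<Union>m<n. (#) n ` decreasing_lists d m)"
proof (intro equalityI subsetI)
  fix ms assume "ms \<in> decreasing_lists (Suc d) n"
  thus "ms \<in> (\<Union>m<n. (#) n ` decreasing_lists d m)"
    by (cases ms) (auto simp: decreasing_lists_def sorted_wrt_greater_Cons_iff simp del: sorted_wrt.simps(2))
qed (auto simp: decreasing_lists_def sorted_wrt_greater_Cons_iff simp del: sorted_wrt.simps(2))

lemma finite_decreasing_lists: "finite (decreasing_lists d n)"
  by (induction d arbitrary: n) (auto simp: decreasing_lists_0 decreasing_lists_Suc)

lemma hcoeff_index_word: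
  assumes "\<forall>k\<in>set ks. k \<ge> 1"
  shows "hcoeff (index_word ks) n =
    of_real (\<Sum>ms\<in>decreasing_lists (length ks) n. \<Prod>j<length ks. 1 / real (ms ! j) ^ (ks ! j))"
  using assms
proof (induction ks arbitrary: n)
  case Nil
  show ?case by (simp add: hcoeff_Nil decreasing_lists_0)
next
  case (Cons k ks)
  let ?g = "\<lambda>ks ms. \<Prod>j<length ks. 1 / real (ms ! j) ^ (ks ! j)"
  let ?d = "length ks"
  have k: "Suc (k - 1) = k" using Cons.prems by simp
  have "(\<Sum>ms\<in>decreasing_lists (Suc ?d) n. ?g (k # ks) ms) =
      (\<Sum>m<n. \<Sum>ms\<in>(#) n ` decreasing_lists ?d m. ?g (k # ks) ms)"
    unfolding decreasing_lists_Suc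
    by (rule sum.UNION_disjoint) (auto simp: finite_decreasing_lists, auto simp: decreasing_lists_def)
  also have "\<dots> = (\<Sum>m<n. (\<Sum>ms\<in>decreasing_lists ?d m. ?g ks ms) / real n ^ k)"
    by (intro sum.cong refl)
      (simp add: sum.reindex inj_on_def prod.lessThan_Suc_shift sum_divide_distrib del: prod.lessThan_Suc)
  finally have "complex_of_real (\<Sum>ms\<in>decreasing_lists (Suc ?d) n. ?g (k # ks) ms) =
      (\<Sum>m<n. hcoeff (index_word ks) m) / of_nat n ^ k"
    using Cons by (simp add: sum_divide_distrib)
  also have "\<dots> = hcoeff (index_word (k # ks)) n"
    using hcoeff_index_block [OF last_index_word [of ks], of "k - 1" n] k by simp
  finally show ?case by simp
qed

section \<open>Convergence at 1 and multiple zeta values\<close>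

lemma summable_norm_hcoeff_L0:
  assumes "u \<noteq> []" "last u = L1"
  shows "summable (\<lambda>n. norm (hcoeff (L0 # u) n))"
proof -
  obtain C where C: "C \<ge> 0" "\<And>n. n \<ge> 1 \<Longrightarrow> norm (hcoeff u n) \<le> C / sqrt n"
    using hcoeff_bound by blast
  \<comment> \<open>The leading zero divides the bound C / sqrt n by n, and the exponent 3/2 exceeds
    1.\<close>
  have "summable (\<lambda>n. C * real n powr (- 3 / 2))"
    by (intro summable_mult) (simp add: summable_real_powr_iff)
  moreover have "norm (norm (hcoeff (L0 # u) n)) \<le> C * real n powr (- 3 / 2)" if "n \<ge> 1" for n
  proof -
    have "real n * norm (hcoeff (L0 # u) n) = norm (hcoeff u n)"
      using arg_cong [OF hcoeff_L0 [OF assms, of n], of norm] by (simp add: norm_mult)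
    hence "norm (hcoeff (L0 # u) n) = norm (hcoeff u n) / real n"
      using that by (simp add: field_simps)
    also have "\<dots> \<le> C / sqrt n / real n" using C that by (intro divide_right_mono) auto
    also have "\<dots> = C * (real n powr (- 1 / 2) * real n powr (- 1))"
      using that by (simp add: powr_minus_divide powr_half_sqrt)
    also have "\<dots> = C * real n powr (- 3 / 2)" by (subst powr_add [symmetric]) simp
    finally show ?thesis by simp
  qed
  ultimately show ?thesis by (rule summable_comparison_test')
qed

text \<open>The series groups the unordered sum in \<open>mzv_def\<close> by the largest summation
  variable; the terms are nonnegative, so convergence of the grouped series justifies the
  regrouping.\<close>

lemma hcoeff_sums_mzv:
  assumes ks: "\<forall>k\<in>set ks. k \<ge> 1" and summable: "summable (\<lambda>n. norm (hcoeff (index_word ks) n))"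
  shows "hcoeff (index_word ks) sums of_real (mzv (rev ks))"
proof -
  let ?d = "length ks"
  let ?g = "\<lambda>ms. \<Prod>j<?d. 1 / real (ms ! j) ^ (ks ! j)"
  let ?c = "\<lambda>n. \<Sum>ms\<in>decreasing_lists ?d n. ?g ms"
  have hc: "hcoeff (index_word ks) n = of_real (?c n)" for n by (rule hcoeff_index_word [OF ks])
  have c0: "?c n \<ge> 0" for n by (intro sum_nonneg prod_nonneg) auto
  have sm: "summable (\<lambda>n. norm (?c n))" using summable unfolding hc norm_of_real real_norm_def .
  have sums: "?c sums suminf ?c" by (rule summable_sums [OF summable_norm_cancel [OF sm]])
  have "(?c has_sum suminf ?c) UNIV" by (rule norm_summable_imp_has_sum [OF sm sums])
  hence c: "(?c has_sum suminf ?c) UNIV" "?c summable_on UNIV" by (auto simp: has_sum_imp_summable)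
  have fin: "((\<lambda>ms. (\<lambda>(n, ms). ?g ms) (n, ms)) has_sum ?c n) (decreasing_lists ?d n)" for n
    using has_sum_finite [OF finite_decreasing_lists] by simp
  have "((\<lambda>(n, ms). ?g ms) has_sum suminf ?c) (Sigma UNIV (decreasing_lists ?d))"
    by (rule has_sum_SigmaI [OF fin c(1)], rule summable_on_SigmaI [OF fin c(2)])
      (auto intro!: prod_nonneg)
  also have "?this \<longleftrightarrow> ((\<lambda>ns. \<Prod>j<?d. 1 / real (ns ! j) ^ (rev ks ! j)) has_sum suminf ?c)
      {ns. length ns = ?d \<and> sorted_wrt (<) ns \<and> (\<forall>n\<in>set ns. 0 < n)}"
  \<comment> \<open>Reversal makes the lists increasing; \<open>hd (rev ns @ [0])\<close> recovers
    the largest entry, with value 0 for the empty list.\<close>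
  proof (rule has_sum_reindex_bij_witness [of _ "\<lambda>ns. (hd (rev ns @ [0]), rev ns)" "\<lambda>(n, ms). rev ms"])
    fix p assume "p \<in> Sigma UNIV (decreasing_lists ?d)"
    then obtain n ms where p: "p = (n, ms)" "length ms = ?d" by (auto simp: decreasing_lists_def)
    have "(\<Prod>j<?d. 1 / real (rev ms ! j) ^ (rev ks ! j)) = ?g ms"
      by (rule prod.reindex_bij_witness [of _ "\<lambda>j. ?d - Suc j" "\<lambda>j. ?d - Suc j"])
        (use p in \<open>auto simp: rev_nth\<close>)
    thus "(\<Prod>j<?d. 1 / real ((case p of (n, ms) \<Rightarrow> rev ms) ! j) ^ (rev ks ! j)) =
        (case p of (n, ms) \<Rightarrow> ?g ms)" by (simp add: p)
  qed (auto simp: decreasing_lists_def sorted_wrt_append sorted_wrt_rev)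
  finally have "mzv (rev ks) = suminf ?c" by (simp add: mzv_def infsumI)
  with sums have "(\<lambda>n. complex_of_real (?c n)) sums of_real (mzv (rev ks))" by (simp only: sums_of_real)
  thus ?thesis by (simp only: flip: hc)
qed

text \<open>Absolute convergence at 1 dominates the series on the whole of [0, 1], so the sum is
  continuous up to 1 and Abel's theorem is avoided.\<close>

lemma hseries_tendsto_1:
  assumes "summable (\<lambda>n. norm (hcoeff w n))"
  shows "((\<lambda>z. nc_coeff (hseries z) w) \<longlongrightarrow> suminf (hcoeff w)) (at_left 1)"
proof -
  have "uniform_limit {0..1} (\<lambda>n z. \<Sum>i<n. hcoeff w i * complex_of_real z ^ i)
      (\<lambda>z. \<Sum>i. hcoeff w i * of_real z ^ i) sequentially"
    by (rule Weierstrass_m_test [OF _ assms])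
      (auto simp: norm_mult norm_power intro!: mult_left_le power_le_one)
  moreover have "\<forall>\<^sub>F n in sequentially.
      continuous_on {0..1} (\<lambda>z. \<Sum>i<n. hcoeff w i * complex_of_real z ^ i)"
    by (intro always_eventually allI continuous_intros)
  ultimately have "continuous_on {0..1::real} (\<lambda>z. nc_coeff (hseries z) w)"
    unfolding hseries_def nc_coeff_Ncps
    by (intro uniform_limit_theorem [OF _ _ sequentially_bot])
  hence "((\<lambda>z. nc_coeff (hseries z) w) \<longlongrightarrow> nc_coeff (hseries 1) w) (at 1 within {0..1})"
    by (simp add: continuous_on)
  thus ?thesis by (simp add: hseries_def at_within_Icc_at_left)
qed

text \<open>Every nonempty suffix of such a word contains \<open>L1\<close> and so has coefficient 0
  in the power of \<open>e0\<close>.\<close>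

lemma nc_coeff_G0_last_L1:
  assumes "z \<in> {0<..<1}" "w \<noteq> []" "last w = L1"
  shows "nc_coeff (G0 z) w = nc_coeff (hseries z) w"
proof -
  have "nc_coeff (hseries z * nc_powr z 1 L0) w =
      (\<Sum>k\<le>length w. if k = length w then nc_coeff (hseries z) w else 0)"
    unfolding nc_coeff_mult
  proof (rule sum.cong)
    fix k assume k: "k \<in> {..length w}"
    show "nc_coeff (hseries z) (take k w) * nc_coeff (nc_powr z 1 L0) (drop k w) =
      (if k = length w then nc_coeff (hseries z) w else 0)"
    proof (cases "k = length w")
      case False
      hence "k < length w" using k by simp
      hence "last (drop k w) = L1" "drop k w \<noteq> []" using assms by auto
      hence "drop k w \<noteq> replicate (length (drop k w)) L0"
        by (metis last_replicate letter.distinct(1) length_0_conv)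
      thus ?thesis using False by (simp add: nc_powr_def nc_coeff_letter_series)
    qed simp
  qed simp
  thus ?thesis using assms by (simp add: G0_eq)
qed

subsection \<open>Reduction to words ending in 1\<close>

text \<open>The derivation sends \<open>e0\<close> to 1, so the commutator with \<open>e0\<close>
  contributes H_n - H_n = 0 besides the commutator of the image. The images J_n thus obey the
  recursion of H_n, but with J_0 = 0 instead of 1, and vanish by induction on the word.\<close>

lemma nc_ins_hterm: "nc_ins L0 (Ncps (\<lambda>w. hcoeff w n)) = 0"
proof (rule ncps_eqI)
  define H where "H n = Ncps (\<lambda>w. hcoeff w n)" for n
  define J where "J n = nc_ins L0 (H n)" for n
  have H0: "H 0 = 1" by (rule ncps_eqI) (simp add: H_def hcoeff_0 nc_coeff_one)
  have rec: "nc_smult (of_nat n) (H n) = e0 * H n - H n * e0 + e1 * (\<Sum>k<n. H k)" for n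
  proof (rule ncps_eqI)
    fix w
    show "nc_coeff (nc_smult (of_nat n) (H n)) w =
        nc_coeff (e0 * H n - H n * e0 + e1 * (\<Sum>k<n. H k)) w"
    proof (cases "w = []")
      case True
      thus ?thesis by (simp add: H_def hcoeff_Nil)
    next
      case False
      thus ?thesis using hcoeff_rec [OF False, of n]
        by (auto simp: H_def nc_coeff_var_mult nc_coeff_mult_var)
    qed
  qed
  have recJ: "nc_smult (of_nat n) (J n) = e0 * J n - J n * e0 + e1 * (\<Sum>k<n. J k)" for n
    using arg_cong [OF rec [of n], of "nc_ins L0"]
    by (simp add: J_def nc_ins_smult nc_ins_add nc_ins_diff nc_ins_mult nc_ins_var nc_ins_sum)
  fix w
  have "nc_coeff (J n) w = 0" for n
  proof (induction w arbitrary: n rule: length_induct)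
    case (1 w)
    show ?case
    proof (cases "n = 0")
      case True
      thus ?thesis by (simp add: J_def H0)
    next
      case False
      have "of_nat n * nc_coeff (J n) w = nc_coeff (e0 * J n - J n * e0 + e1 * (\<Sum>k<n. J k)) w"
        by (simp flip: recJ)
      also have "\<dots> = 0"
        using 1 by (cases "w = []") (auto simp: nc_coeff_var_mult nc_coeff_mult_var)
      finally show ?thesis using False by simp
    qed
  qed
  thus "nc_coeff (nc_ins L0 (Ncps (\<lambda>w. hcoeff w n))) w = nc_coeff 0 w" by (simp add: J_def H_def)
qed

lemma nc_ins_hseries:
  assumes "\<bar>z\<bar> < 1"
  shows "nc_ins L0 (hseries z) = 0"
proof (rule ncps_eqI)
  fix w
  have "(\<lambda>n. \<Sum>i\<le>length w. hcoeff (take i w @ L0 # drop i w) n * of_real z ^ n) sums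
      nc_coeff (nc_ins L0 (hseries z)) w"
    unfolding nc_coeff_ins by (intro sums_sum hseries_sums assms)
  moreover have "(\<Sum>i\<le>length w. hcoeff (take i w @ L0 # drop i w) n * of_real z ^ n) = 0" for n
    using arg_cong [OF nc_ins_hterm [of n], of "\<lambda>f. nc_coeff f w"]
    by (simp add: nc_coeff_ins flip: sum_distrib_right)
  ultimately show "nc_coeff (nc_ins L0 (hseries z)) w = nc_coeff 0 w"
    using sums_unique2 [OF _ sums_zero] by simp
qed

text \<open>The shuffle relation of \<open>G0\<close> with log z, which is its coefficient on
  \<open>[L0]\<close>.\<close>

lemma nc_ins_G0:
  assumes "z \<in> {0<..<1}"
  shows "nc_ins L0 (G0 z) = nc_smult (of_real (ln z)) (G0 z)"
  using assms by (simp add: G0_eq nc_ins_mult nc_ins_hseries nc_ins_powr nc_smult_mult_right)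

subsection \<open>The algebra of multiple zeta values\<close>

lemma of_nat_in_rat_algebra: "of_nat n \<in> rat_algebra S"
  using rat_algebra.scalar [of "of_nat n" S] by simp

lemma uminus_in_rat_algebra: "x \<in> rat_algebra S \<Longrightarrow> - x \<in> rat_algebra S"
  using rat_algebra.mult [OF rat_algebra.scalar [of "-1" S]] by fastforce

lemma power_in_rat_algebra: "x \<in> rat_algebra S \<Longrightarrow> x ^ n \<in> rat_algebra S"
  by (induction n) (use of_nat_in_rat_algebra [of 1 S] in \<open>auto intro: rat_algebra.mult\<close>)

lemma sum_in_rat_algebra:
  "(\<And>i. i \<in> I \<Longrightarrow> f i \<in> rat_algebra S) \<Longrightarrow> sum f I \<in> rat_algebra S"
  by (induction I rule: infinite_finite_induct)
    (use of_nat_in_rat_algebra [of 0 S] in \<open>auto intro: rat_algebra.add\<close>)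

lemma divide_nat_in_rat_algebra:
  assumes "x \<in> rat_algebra S"
  shows "x / of_nat n \<in> rat_algebra S"
  using rat_algebra.mult [OF assms rat_algebra.scalar [of "1 / of_nat n" S]]
  by (simp add: of_rat_divide)

section \<open>Limits of the solution at 1 on words beginning with 0\<close>

lemma eventually_at_left_1: "\<forall>\<^sub>F z in at_left 1. z \<in> {0<..<1::real}"
  using eventually_at_left_real [of 0 "1::real"] by simp

lemma ln_mult_tendsto_0:
  fixes f :: "real \<Rightarrow> complex"
  assumes "(f \<longlongrightarrow> L) (at_left 1)"
  shows "((\<lambda>z. of_real (ln z) * f z) \<longlongrightarrow> 0) (at_left 1)"
proof -
  have "((\<lambda>z::real. ln z) \<longlongrightarrow> 0) (at_left 1)" by real_asymp
  from tendsto_mult [OF tendsto_of_real [OF this] assms] show ?thesis by simp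
qed

lemma G0_tendsto_1_replicate:
  "\<exists>L\<in>mzv_algebra. ((\<lambda>z. nc_coeff (G0 z) (replicate n L0)) \<longlongrightarrow> L) (at_left 1)"
proof (induction n)
  case 0
  have "((\<lambda>z. nc_coeff (G0 z) (replicate 0 L0)) \<longlongrightarrow> 1) (at_left 1)"
    by (intro tendsto_eventually eventually_mono [OF eventually_at_left_1]) (simp add: nc_coeff_G0_Nil)
  thus ?case using of_nat_in_rat_algebra [of 1] unfolding mzv_algebra_def by fastforce
next
  case (Suc n)
  then obtain L where "((\<lambda>z. nc_coeff (G0 z) (replicate n L0)) \<longlongrightarrow> L) (at_left 1)" by blast
  from tendsto_divide [OF ln_mult_tendsto_0 [OF this] tendsto_const [of "of_nat (Suc n)"]]
  have "((\<lambda>z. of_real (ln z) * nc_coeff (G0 z) (replicate n L0) / of_nat (Suc n)) \<longlongrightarrow> 0) (at_left 1)"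
    by (simp del: of_nat_Suc)
  hence "((\<lambda>z. nc_coeff (G0 z) (replicate (Suc n) L0)) \<longlongrightarrow> 0) (at_left 1)"
  proof (rule Lim_transform_eventually [OF _ eventually_mono [OF eventually_at_left_1]])
    fix z :: real assume z: "z \<in> {0<..<1}"
    have *: "take i (replicate n L0) @ L0 # drop i (replicate n L0) = replicate (Suc n) L0" if "i \<le> n" for i
      using that by (intro replicate_eqI) (auto dest: in_set_takeD in_set_dropD)
    have "of_nat (Suc n) * nc_coeff (G0 z) (replicate (Suc n) L0) =
        nc_coeff (nc_ins L0 (G0 z)) (replicate n L0)"
      using * by (simp add: nc_coeff_ins del: replicate_Suc take_replicate drop_replicate of_nat_Suc)
    thus "of_real (ln z) * nc_coeff (G0 z) (replicate n L0) / of_nat (Suc n) =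
        nc_coeff (G0 z) (replicate (Suc n) L0)"
      by (simp add: nc_ins_G0 [OF z] field_simps del: of_nat_Suc)
  qed
  thus ?case using of_nat_in_rat_algebra [of 0] unfolding mzv_algebra_def by fastforce
qed

text \<open>Insert a zero into the word with n trailing zeros. The n + 1 slots behind the last
  \<open>L1\<close> all give the word with n + 1 trailing zeros; the other slots give words with n
  of them, still beginning with \<open>L0\<close>. The sum of all is log z times a convergent
  coefficient and tends to 0, so division by n + 1 yields the new limit.\<close>

lemma G0_tendsto_1_block:
  "\<exists>L\<in>mzv_algebra. ((\<lambda>z. nc_coeff (G0 z) (L0 # v @ L1 # replicate n L0)) \<longlongrightarrow> L) (at_left 1)"
proof (induction n arbitrary: v)
  case 0
  let ?u = "v @ [L1]"
  obtain ks where ks: "\<forall>k\<in>set ks. k \<ge> 1" "L0 # ?u = index_word ks"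
    using ex_index_word [of "L0 # ?u"] by auto
  have "ks \<noteq> []" using ks by (cases ks) auto
  \<comment> \<open>A first index 1 would make the word begin with \<open>L1\<close>; this is the
    convergence condition on the last index of \<open>rev ks\<close>.\<close>
  moreover have "hd ks \<ge> 2"
  proof (cases ks)
    case (Cons k ks')
    have "k \<noteq> 0" "k \<noteq> 1" using ks Cons by auto
    thus ?thesis using Cons by simp
  qed (use \<open>ks \<noteq> []\<close> in auto)
  ultimately have "mzv_index (rev ks)" using ks by (simp add: mzv_index_def last_rev)
  hence "complex_of_real (mzv (rev ks)) \<in> mzv_algebra"
    unfolding mzv_algebra_def by (intro rat_algebra.gen) auto
  moreover have "summable (\<lambda>n. norm (hcoeff (L0 # ?u) n))" by (rule summable_norm_hcoeff_L0) auto
  hence "((\<lambda>z. nc_coeff (hseries z) (L0 # ?u)) \<longlongrightarrow> of_real (mzv (rev ks))) (at_left 1)"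
    using hseries_tendsto_1 [of "L0 # ?u"] hcoeff_sums_mzv [OF ks(1)] sums_unique ks(2) by metis
  hence "((\<lambda>z. nc_coeff (G0 z) (L0 # ?u)) \<longlongrightarrow> of_real (mzv (rev ks))) (at_left 1)"
    by (rule Lim_transform_eventually [OF _ eventually_mono [OF eventually_at_left_1]])
      (simp add: nc_coeff_G0_last_L1)
  ultimately show ?case by auto
next
  case (Suc n)
  define w where "w k = L0 # v @ L1 # replicate k L0" for k
  define m where "m = Suc (length v)"
  \<comment> \<open>The middle part after inserting at slot i: slot 0 lies before the leading
    \<open>L0\<close>, and slot i > 0 is position i - 1 of \<open>v\<close>.\<close>
  define x where "x i = (if i = 0 then L0 # v else take (i - 1) v @ L0 # drop (i - 1) v)" for i
  have front: "take i (w n) @ L0 # drop i (w n) = L0 # x i @ L1 # replicate n L0" if "i \<le> m" for i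
    using that by (cases i) (auto simp: w_def x_def m_def)
  have rear: "take i (w n) @ L0 # drop i (w n) = w (Suc n)" if i: "i \<in> {Suc m..length (w n)}" for i
  proof -
    obtain j where j: "i = Suc m + j" "j \<le> n" using i
      by (auto simp: w_def m_def nat_le_iff_add)
    have "replicate j L0 @ L0 # replicate (n - j) L0 = replicate (Suc n) L0"
      using j by (intro replicate_eqI) auto
    thus ?thesis using j by (simp add: w_def m_def min_absorb1)
  qed
  obtain L where L: "((\<lambda>z. nc_coeff (G0 z) (w n)) \<longlongrightarrow> L) (at_left 1)"
    using Suc.IH [of v] by (auto simp: w_def)
  obtain M where M: "\<And>v. M v \<in> mzv_algebra"
      "\<And>v. ((\<lambda>z. nc_coeff (G0 z) (L0 # v @ L1 # replicate n L0)) \<longlongrightarrow> M v) (at_left 1)"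
    using Suc.IH by metis
  have "((\<lambda>z. (of_real (ln z) * nc_coeff (G0 z) (w n) -
      (\<Sum>i\<le>m. nc_coeff (G0 z) (L0 # x i @ L1 # replicate n L0))) / of_nat (Suc n)) \<longlongrightarrow>
      (0 - (\<Sum>i\<le>m. M (x i))) / of_nat (Suc n)) (at_left 1)"
    by (intro tendsto_divide tendsto_diff ln_mult_tendsto_0 [OF L] tendsto_sum M tendsto_const)
      (simp del: of_nat_Suc)
  hence "((\<lambda>z. nc_coeff (G0 z) (w (Suc n))) \<longlongrightarrow> (0 - (\<Sum>i\<le>m. M (x i))) / of_nat (Suc n)) (at_left 1)"
  proof (rule Lim_transform_eventually [OF _ eventually_mono [OF eventually_at_left_1]])
    fix z :: real assume z: "z \<in> {0<..<1}"
    have len: "length (w n) = m + Suc n" by (simp add: w_def m_def)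
    have "of_real (ln z) * nc_coeff (G0 z) (w n) = nc_coeff (nc_ins L0 (G0 z)) (w n)"
      by (simp add: nc_ins_G0 [OF z])
    also have "\<dots> = (\<Sum>i\<in>{..m} \<union> {Suc m..length (w n)}. nc_coeff (G0 z) (take i (w n) @ L0 # drop i (w n)))"
      unfolding nc_coeff_ins by (rule sum.cong) (auto simp: len)
    also have "\<dots> = (\<Sum>i\<le>m. nc_coeff (G0 z) (take i (w n) @ L0 # drop i (w n))) +
        (\<Sum>i\<in>{Suc m..length (w n)}. nc_coeff (G0 z) (take i (w n) @ L0 # drop i (w n)))"
      by (rule sum.union_disjoint) auto
    also have "(\<Sum>i\<le>m. nc_coeff (G0 z) (take i (w n) @ L0 # drop i (w n))) =
        (\<Sum>i\<le>m. nc_coeff (G0 z) (L0 # x i @ L1 # replicate n L0))"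
      by (rule sum.cong) (simp_all add: front)
    also have "(\<Sum>i\<in>{Suc m..length (w n)}. nc_coeff (G0 z) (take i (w n) @ L0 # drop i (w n))) =
        of_nat (Suc n) * nc_coeff (G0 z) (w (Suc n))"
      by (subst sum.cong [OF refl, of _ _ "\<lambda>_. nc_coeff (G0 z) (w (Suc n))"]) (simp_all add: rear len)
    finally show "(of_real (ln z) * nc_coeff (G0 z) (w n) -
      (\<Sum>i\<le>m. nc_coeff (G0 z) (L0 # x i @ L1 # replicate n L0))) / of_nat (Suc n) =
      nc_coeff (G0 z) (w (Suc n))"
      by (simp add: field_simps del: of_nat_Suc)
  qed
  moreover have "(0 - (\<Sum>i\<le>m. M (x i))) / of_nat (Suc n) \<in> mzv_algebra"
    using M(1) unfolding mzv_algebra_def diff_0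
    by (intro divide_nat_in_rat_algebra uminus_in_rat_algebra sum_in_rat_algebra)
  ultimately show ?case unfolding w_def by blast
qed

lemma G0_tendsto_1:
  "\<exists>L\<in>mzv_algebra. ((\<lambda>z. nc_coeff (G0 z) (L0 # v)) \<longlongrightarrow> L) (at_left 1)"
proof (cases "set v \<subseteq> {L0}")
  case True
  hence "v = replicate (length v) L0" by (simp only: eq_replicate_iff)
  hence "L0 # v = replicate (Suc (length v)) L0" by (metis replicate_Suc)
  thus ?thesis using G0_tendsto_1_replicate by metis
next
  case False
  hence "L1 \<in> set v" using letter.exhaust by blast
  then obtain ys zs where "v = ys @ L1 # zs" "L1 \<notin> set zs" using split_list_last by metis
  moreover have "zs = replicate (length zs) L0"
    using calculation(2) by (metis letter.exhaust replicate_length_same)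
  ultimately show ?thesis using G0_tendsto_1_block by metis
qed

text \<open>The coefficient is the limit of \<open>G1\<close> at 0, and reflection turns it, up to
  sign, into a limit of \<open>G0\<close> at 1 on a word beginning with \<open>L0\<close>.\<close>

lemma inv_associator_in_mzv_algebra: "nc_coeff (nc_inv associator) (L1 # u) \<in> mzv_algebra"
proof -
  obtain L where L: "L \<in> mzv_algebra"
      "((\<lambda>z. nc_coeff (G0 z) (L0 # map swap_letter u)) \<longlongrightarrow> L) (at_left 1)"
    using G0_tendsto_1 by blast
  from tendsto_mult_left [OF filterlim_compose [OF L(2) filterlim_one_minus(2)], of "(-1) ^ Suc (length u)"]
  have "((\<lambda>z. nc_coeff (G1 z) (L1 # u)) \<longlongrightarrow> (-1) ^ Suc (length u) * L) (at_right 0)"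
    by (simp add: G1_eq)
  hence "nc_coeff (nc_inv associator) (L1 # u) = (-1) ^ Suc (length u) * L"
    using G1_tendsto_0 tendsto_unique [OF trivial_limit_at_right_real] by blast
  moreover have "(-1) ^ n * L \<in> mzv_algebra" for n
    using L(1) uminus_in_rat_algebra [OF of_nat_in_rat_algebra [of 1]]
    unfolding mzv_algebra_def by (intro rat_algebra.mult power_in_rat_algebra) auto
  ultimately show ?thesis by (simp only:)
qed

section \<open>Integrals of solutions\<close>

text \<open>Integrating C (1-t)^(-3/2) gives 2 C (1-t)^(-1/2), so the shape of the bound survives
  each letter; \<open>?M\<close> is the constant of integration at 1/2.\<close>

lemma kz_solution_growth_right:
  assumes "kz_solution G"
  shows "\<exists>C\<ge>0. \<forall>z\<in>{1/2..<1}. norm (nc_coeff (G z) w) \<le> C / sqrt (1 - z)"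
proof (induction w)
  case Nil
  obtain c where c: "\<And>z. z \<in> {0<..<1} \<Longrightarrow> nc_coeff (G z) [] = c"
    using kz_solution_zero_derivative [OF assms, of "[]"] by auto
  have "norm c \<le> norm c / sqrt (1 - z)" if "z \<in> {1/2..<1}" for z
    using that by (simp add: pos_le_divide_eq mult_left_le)
  thus ?case using c by (intro exI [of _ "norm c"]) auto
next
  case (Cons a u)
  then obtain C where C: "C \<ge> 0"
      "\<And>z. z \<in> {1/2..<1} \<Longrightarrow> norm (nc_coeff (G z) u) \<le> C / sqrt (1 - z)" by blast
  let ?f = "\<lambda>z. nc_coeff (G z) (a # u)" and ?M = "norm (nc_coeff (G (1/2)) (a # u))"
  have "norm (?f z) \<le> (?M + 2 * C) / sqrt (1 - z)" if z: "z \<in> {1/2..<1}" for z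
  proof -
    have pos: "\<bar>z\<bar> < 1" "sqrt (1 - z) > 0" "sqrt (1 - z) \<le> 1" using z by auto
    have *: "norm (?f z) \<le> ?M + 2 * C / sqrt (1 - z)"
    proof (cases "z = 1/2")
      case False
      have "norm (?f z - ?f (1/2)) \<le> 2 * C / sqrt (1 - z) - 2 * C / sqrt (1 - 1/2)"
      proof (rule differentiable_bound_general [where f' = "\<lambda>t. of_real (kz_form a t) * nc_coeff (G t) u"
            and \<phi>' = "\<lambda>t. 1 / (1 - t) * (C / sqrt (1 - t))"])
        show "1/2 < z" using z False by auto
        show "continuous_on {1/2..z} (\<lambda>z. 2 * C / sqrt (1 - z))"
          using z by (intro continuous_intros) auto
        have "isCont ?f t" if "t \<in> {1/2..z}" for t
          using kz_solution_Cons [OF assms, of t a u] that z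
          by (intro has_vector_derivative_continuous) auto
        thus "continuous_on {1/2..z} ?f" by (simp add: continuous_at_imp_continuous_on)
        fix t assume t: "1/2 < t" "t < z"
        show "(?f has_vector_derivative of_real (kz_form a t) * nc_coeff (G t) u) (at t)"
          using kz_solution_Cons [OF assms, of t a u] t z by auto
        have "((\<lambda>z. 2 * C / sqrt (1 - z)) has_real_derivative 1 / (1 - t) * (C / sqrt (1 - t))) (at t)"
          using t z by (auto intro!: derivative_eq_intros simp: field_simps)
        thus "((\<lambda>z. 2 * C / sqrt (1 - z)) has_vector_derivative 1 / (1 - t) * (C / sqrt (1 - t))) (at t)"
          by (simp add: has_real_derivative_iff_has_vector_derivative)
        \<comment> \<open>For t above 1/2 also 1/t is at most 1/(1-t), so both letters are handled
          alike.\<close>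
        have "\<bar>kz_form a t\<bar> \<le> 1 / (1 - t)"
          using t z by (cases a) (auto simp: kz_form_def intro!: divide_left_mono)
        thus "norm (of_real (kz_form a t) * nc_coeff (G t) u) \<le> 1 / (1 - t) * (C / sqrt (1 - t))"
          unfolding norm_mult norm_of_real using t z by (intro mult_mono C) auto
      qed
      moreover have "2 * C / sqrt (1 - 1/2) \<ge> 0" using C by simp
      ultimately show ?thesis using norm_triangle_ineq2 [of "?f z" "?f (1/2)"] by linarith
    next
      case True
      hence "norm (?f z) = ?M" by (simp only:)
      moreover have "2 * C / sqrt (1 - z) \<ge> 0" using C pos by simp
      ultimately show ?thesis by linarith
    qed
    have "?M \<le> ?M / sqrt (1 - z)" using pos by (simp add: pos_le_divide_eq mult_left_le)
    with * show ?thesis by (simp add: add_divide_distrib)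
  qed
  thus ?case using C by (intro exI [of _ "?M + 2 * C"]) auto
qed

lemma kz_solution_growth:
  assumes "kz_solution G"
  obtains C where "C \<ge> 0"
    "\<And>z. z \<in> {0<..<1} \<Longrightarrow> norm (nc_coeff (G z) w) \<le> C * (1 / sqrt z + 1 / sqrt (1 - z))"
proof -
  obtain C where C: "C \<ge> 0"
      "\<And>z. z \<in> {1/2..<1} \<Longrightarrow> norm (nc_coeff (G z) w) \<le> C / sqrt (1 - z)"
    using kz_solution_growth_right [OF assms] by blast
  obtain D where D: "D \<ge> 0"
      "\<And>z. z \<in> {1/2..<1} \<Longrightarrow> norm (nc_coeff (nc_swap (G (1 - z))) (map swap_letter w)) \<le> D / sqrt (1 - z)"
    using kz_solution_growth_right [OF kz_solution_swap [OF assms]] by blast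
  show ?thesis
  proof (rule that [of "C + D"])
    show "C + D \<ge> 0" using C D by simp
    fix z :: real assume z: "z \<in> {0<..<1}"
    have nonneg: "C / sqrt (1 - z) \<ge> 0" "C / sqrt z \<ge> 0" "D / sqrt (1 - z) \<ge> 0" "D / sqrt z \<ge> 0"
      using C D z by auto
    have "norm (nc_coeff (G z) w) \<le> C / sqrt (1 - z) \<or> norm (nc_coeff (G z) w) \<le> D / sqrt z"
    proof (cases "z \<ge> 1/2")
      case True
      thus ?thesis using C(2) [of z] z by auto
    next
      case False
      thus ?thesis using D(2) [of "1 - z"] z by (auto simp: norm_mult norm_power o_def)
    qed
    thus "norm (nc_coeff (G z) w) \<le> (C + D) * (1 / sqrt z + 1 / sqrt (1 - z))"
      using nonneg by (auto simp: algebra_simps add_divide_distrib)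
  qed
qed

section \<open>Continuity and vanishing boundary terms\<close>

lemma kz_solution_isCont:
  assumes "kz_solution G" "z \<in> {0<..<1}"
  shows "isCont (\<lambda>z. nc_coeff (G z) w) z"
  using assms unfolding kz_solution_iff nc_has_deriv_def
  by (meson has_vector_derivative_continuous)

lemma kz_solution_tendsto_0:
  assumes "kz_solution G"
  shows "((\<lambda>z. of_real z * nc_coeff (G z) w) \<longlongrightarrow> 0) (at_right 0)"
proof -
  obtain C where C: "C \<ge> 0"
    "\<And>z. z \<in> {0<..<1} \<Longrightarrow> norm (nc_coeff (G z) w) \<le> C * (1 / sqrt z + 1 / sqrt (1 - z))"
    using kz_solution_growth [OF assms] by blast
  have "((\<lambda>z::real. C * (z * (1 / sqrt z + 1 / sqrt (1 - z)))) \<longlongrightarrow> C * 0) (at_right 0)"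
    by (intro tendsto_mult_left) real_asymp
  hence lim: "((\<lambda>z::real. C * (z * (1 / sqrt z + 1 / sqrt (1 - z)))) \<longlongrightarrow> 0) (at_right 0)" by simp
  have ev: "\<forall>\<^sub>F z in at_right 0. z \<in> {0<..<1::real}"
    using eventually_at_right_real [of 0 "1::real"] by simp
  show ?thesis
  proof (rule Lim_null_comparison [OF eventually_mono [OF ev] lim])
    fix z :: real assume z: "z \<in> {0<..<1}"
    have "norm (of_real z * nc_coeff (G z) w) = z * norm (nc_coeff (G z) w)"
      using z by (simp add: norm_mult)
    also have "\<dots> \<le> z * (C * (1 / sqrt z + 1 / sqrt (1 - z)))"
      using C(2) [OF z] z by (intro mult_left_mono) auto
    finally show "norm (of_real z * nc_coeff (G z) w) \<le> C * (z * (1 / sqrt z + 1 / sqrt (1 - z)))"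
      by (simp only: mult_ac)
  qed
qed

lemma kz_solution_tendsto_1:
  assumes "kz_solution G"
  shows "((\<lambda>z. of_real (z - 1) * nc_coeff (G z) w) \<longlongrightarrow> 0) (at_left 1)"
proof -
  let ?v = "map swap_letter w"
  have "((\<lambda>z. of_real z * nc_coeff (nc_swap (G (1 - z))) ?v) \<longlongrightarrow> 0) (at_right 0)"
    by (rule kz_solution_tendsto_0 [OF kz_solution_swap [OF assms]])
  from tendsto_mult_left [OF filterlim_compose [OF this filterlim_one_minus(1)], of "- ((-1) ^ length w)"]
  have "((\<lambda>z. - ((-1) ^ length w) * (of_real (1 - z) * ((-1) ^ length w * nc_coeff (G z) w))) \<longlongrightarrow> 0) (at_left 1)"
    by (simp add: o_def)
  moreover have "- ((-1) ^ length w) * (of_real (1 - z) * ((-1) ^ length w * x)) = of_real (z - 1) * x"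
    for z :: real and x :: complex
  proof -
    have "- ((-1) ^ length w) * (of_real (1 - z) * ((-1) ^ length w * x)) =
        ((-1) ^ length w * (-1) ^ length w) * (- (of_real (1 - z) * x))" by (simp only: mult_ac mult_minus_left mult_minus_right)
    thus ?thesis by (simp add: left_diff_distrib flip: power_mult_distrib)
  qed
  ultimately show ?thesis by simp
qed

section \<open>Integrability and the fundamental theorem of calculus\<close>

lemma einterval_0_1: "einterval 0 1 = {0<..<1::real}"
  by (auto simp: einterval_def zero_ereal_def one_ereal_def)

lemma set_integrable_inverse_sqrt:
  "set_integrable lborel {0<..<1::real} (\<lambda>z. 1 / sqrt z + 1 / sqrt (1 - z))"
proof -
  have "set_integrable lborel (einterval 0 1) (\<lambda>z. 1 / sqrt z + 1 / sqrt (1 - z))"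
  proof (rule interval_integral_FTC_nonneg(1) [where F = "\<lambda>z. 2 * sqrt z - 2 * sqrt (1 - z)"])
    fix x :: real assume "0 < ereal x" "ereal x < 1"
    hence x: "0 < x" "x < 1" by auto
    show "((\<lambda>z. 2 * sqrt z - 2 * sqrt (1 - z)) has_real_derivative 1 / sqrt x + 1 / sqrt (1 - x)) (at x)"
      using x by (auto intro!: derivative_eq_intros simp: field_simps)
    show "isCont (\<lambda>z. 1 / sqrt z + 1 / sqrt (1 - z)) x"
      using x by (intro continuous_intros) auto
  next
    have "((\<lambda>z::real. 2 * sqrt z - 2 * sqrt (1 - z)) \<longlongrightarrow> -2) (at_right 0)" by real_asymp
    thus "(((\<lambda>z. 2 * sqrt z - 2 * sqrt (1 - z)) \<circ> real_of_ereal) \<longlongrightarrow> -2) (at_right 0)"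
      by (simp add: zero_ereal_def ereal_tendsto_simps)
    have "((\<lambda>z::real. 2 * sqrt z - 2 * sqrt (1 - z)) \<longlongrightarrow> 2) (at_left 1)" by real_asymp
    thus "(((\<lambda>z. 2 * sqrt z - 2 * sqrt (1 - z)) \<circ> real_of_ereal) \<longlongrightarrow> 2) (at_left 1)"
      by (simp add: one_ereal_def ereal_tendsto_simps)
  qed auto
  thus ?thesis by (simp only: einterval_0_1)
qed

lemma set_integrable_kz_solution:
  assumes "kz_solution G"
  shows "set_integrable lborel {0<..<1} (\<lambda>z. nc_coeff (G z) w)"
proof -
  obtain C where C: "C \<ge> 0"
    "\<And>z. z \<in> {0<..<1} \<Longrightarrow> norm (nc_coeff (G z) w) \<le> C * (1 / sqrt z + 1 / sqrt (1 - z))"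
    using kz_solution_growth [OF assms] by blast
  show ?thesis
  proof (rule set_integrable_bound)
    show "set_integrable lborel {0<..<1} (\<lambda>z. C * (1 / sqrt z + 1 / sqrt (1 - z)))"
      by (intro set_integrable_mult_right set_integrable_inverse_sqrt)
    have "continuous_on {0<..<1} (\<lambda>z. nc_coeff (G z) w)"
      using kz_solution_isCont [OF assms] by (simp add: continuous_at_imp_continuous_on)
    thus "set_borel_measurable lborel {0<..<1} (\<lambda>z. nc_coeff (G z) w)"
      unfolding set_borel_measurable_def
      using borel_measurable_continuous_on_indicator [of "{0<..<1::real}"] by simp
    show "AE z in lborel. z \<in> {0<..<1} \<longrightarrow>
        norm (nc_coeff (G z) w) \<le> norm (C * (1 / sqrt z + 1 / sqrt (1 - z)))"
      by (intro AE_I2 impI) (metis C(2) abs_ge_self order.trans real_norm_def)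
  qed
qed

lemma set_integral_FTC:
  fixes f F :: "real \<Rightarrow> complex"
  assumes "\<And>z. z \<in> {0<..<1} \<Longrightarrow> (F has_vector_derivative f z) (at z)"
    and "\<And>z. z \<in> {0<..<1} \<Longrightarrow> isCont f z"
    and "set_integrable lborel {0<..<1} f"
    and "(F \<longlongrightarrow> A) (at_right 0)" "(F \<longlongrightarrow> B) (at_left 1)"
  shows "(LINT z:{0<..<1}|lborel. f z) = B - A"
proof -
  have "(LBINT z=0..1. f z) = B - A"
    by (rule interval_integral_FTC_integrable [where F = F])
      (use assms in \<open>auto simp: einterval_0_1 zero_ereal_def one_ereal_def ereal_tendsto_simps\<close>)
  thus ?thesis by (simp add: interval_lebesgue_integral_def einterval_0_1)
qed

definition G1_integral :: ncps where
  "G1_integral = Ncps (\<lambda>w. LINT z:{0<..<1}|lborel. nc_coeff (G1 z) w)"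

text \<open>The primitive z G_1 - P is treated word by word. Its coefficient is z times that of
  \<open>G1\<close> on words beginning with \<open>L0\<close>, and z - 1 times it on words beginning
  with \<open>L1\<close>, where P has the same coefficient as \<open>G1\<close>.\<close>

lemma G1_integral:
  "(1 + e0 - e1) * G1_integral = 1 + e1 * nc_tail L1 (nc_inv associator)"
proof (rule ncps_eqI)
  fix w
  let ?I = "\<lambda>w. LINT z:{0<..<1}|lborel. nc_coeff (G1 z) w"
  note int = set_integrable_kz_solution [OF kz_solution_G1]
  note cont = kz_solution_isCont [OF kz_solution_G1]
  note Cons = kz_solution_Cons [OF kz_solution_G1]
  have tendsto_id: "(complex_of_real \<longlongrightarrow> of_real a) (at a within S)" for a S
    by (intro tendsto_intros)
  consider "w = []" | u where "w = L0 # u" | u where "w = L1 # u"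
    by (metis letter.exhaust list.exhaust)
  thus "nc_coeff ((1 + e0 - e1) * G1_integral) w =
      nc_coeff (1 + e1 * nc_tail L1 (nc_inv associator)) w"
  proof cases
    case 1
    have "?I [] = (LINT z:{0<..<1::real}|lborel. (1::complex))"
      by (intro set_lebesgue_integral_cong) (auto simp: nc_coeff_G1_Nil)
    also have "\<dots> = of_real 1 - of_real 0"
    proof (rule set_integral_FTC [OF _ _ _ tendsto_id tendsto_id])
      show "(complex_of_real has_vector_derivative 1) (at z)" for z
        using has_vector_derivative_of_real [OF DERIV_ident, of "at z"] by simp
      have "set_integrable lborel {0<..<1::real} (\<lambda>z. nc_coeff (G1 z) [])" by (rule int)
      also have "?this \<longleftrightarrow> set_integrable lborel {0<..<1::real} (\<lambda>z. 1 :: complex)"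
        by (intro set_integrable_cong) (auto simp: nc_coeff_G1_Nil)
      finally show "set_integrable lborel {0<..<1::real} (\<lambda>z. 1 :: complex)" .
    qed auto
    finally show ?thesis using 1 by (simp add: G1_integral_def left_diff_distrib distrib_right nc_coeff_one)
  next
    case (2 u)
    have "?I w + ?I u = (LINT z:{0<..<1}|lborel. nc_coeff (G1 z) w + nc_coeff (G1 z) u)"
      by (rule set_integral_add(2) [symmetric]) (rule int)+
    also have "\<dots> = of_real 1 * 0 - 0"
    proof (rule set_integral_FTC [where F = "\<lambda>z. of_real z * nc_coeff (G1 z) w"])
      fix z :: real assume z: "z \<in> {0<..<1}"
      from has_vector_derivative_mult [OF has_vector_derivative_of_real [OF DERIV_ident] Cons [OF z, of L0 u]]
      show "((\<lambda>z. of_real z * nc_coeff (G1 z) w) has_vector_derivative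
          nc_coeff (G1 z) w + nc_coeff (G1 z) u) (at z)"
        using z 2 by (simp add: kz_form_def add.commute)
      show "isCont (\<lambda>z. nc_coeff (G1 z) w + nc_coeff (G1 z) u) z"
        by (intro continuous_intros cont z)
    next
      show "set_integrable lborel {0<..<1} (\<lambda>z. nc_coeff (G1 z) w + nc_coeff (G1 z) u)"
        by (intro set_integral_add int)
      show "((\<lambda>z. of_real z * nc_coeff (G1 z) w) \<longlongrightarrow> 0) (at_right 0)"
        by (rule kz_solution_tendsto_0 [OF kz_solution_G1])
      show "((\<lambda>z. of_real z * nc_coeff (G1 z) w) \<longlongrightarrow> of_real 1 * 0) (at_left 1)"
        unfolding 2 by (intro tendsto_mult tendsto_id G1_tendsto_1)
    qed
    finally show ?thesis using 2 by (simp add: G1_integral_def left_diff_distrib distrib_right nc_coeff_one)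
  next
    case (3 u)
    let ?b = "nc_coeff (nc_inv associator) w"
    have "?I w - ?I u = (LINT z:{0<..<1}|lborel. nc_coeff (G1 z) w - nc_coeff (G1 z) u)"
      by (rule set_integral_diff(2) [symmetric]) (rule int)+
    also have "\<dots> = 0 - of_real (0 - 1) * ?b"
    \<comment> \<open>The factor z - 1 turns dz/(1-z) into -dz, which produces the minus sign of
      \<open>e1\<close>; it also kills the boundary term at 1, so only the value at 0
      remains.\<close>
    proof (rule set_integral_FTC [where F = "\<lambda>z. of_real (z - 1) * nc_coeff (G1 z) w"])
      fix z :: real assume z: "z \<in> {0<..<1}"
      have "((\<lambda>z. z - 1) has_real_derivative 1) (at z)" by (auto intro!: derivative_eq_intros)
      from has_vector_derivative_mult [OF has_vector_derivative_of_real [OF this] Cons [OF z, of L1 u]]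
      have "((\<lambda>z. of_real (z - 1) * nc_coeff (G1 z) w) has_vector_derivative
          of_real ((z - 1) * kz_form L1 z) * nc_coeff (G1 z) u + nc_coeff (G1 z) w) (at z)"
        using 3 by (simp add: mult.assoc)
      moreover have "(z - 1) * kz_form L1 z = -1" using z by (simp add: kz_form_def field_simps)
      ultimately show "((\<lambda>z. of_real (z - 1) * nc_coeff (G1 z) w) has_vector_derivative
          nc_coeff (G1 z) w - nc_coeff (G1 z) u) (at z)" by simp
      show "isCont (\<lambda>z. nc_coeff (G1 z) w - nc_coeff (G1 z) u) z"
        by (intro continuous_intros cont z)
    next
      show "set_integrable lborel {0<..<1} (\<lambda>z. nc_coeff (G1 z) w - nc_coeff (G1 z) u)"
        by (intro set_integral_diff int)
      show "((\<lambda>z. of_real (z - 1) * nc_coeff (G1 z) w) \<longlongrightarrow> 0) (at_left 1)"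
        by (rule kz_solution_tendsto_1 [OF kz_solution_G1])
      show "((\<lambda>z. of_real (z - 1) * nc_coeff (G1 z) w) \<longlongrightarrow> of_real (0 - 1) * ?b) (at_right 0)"
        unfolding 3 by (intro tendsto_mult tendsto_of_real tendsto_intros G1_tendsto_0)
    qed
    finally show ?thesis using 3 by (simp add: G1_integral_def left_diff_distrib distrib_right nc_coeff_one)
  qed
qed

section \<open>Evaluation at word matrices\<close>

lemma word_matrix_carrier [simp]:
  "word_matrix w a \<in> carrier_mat (length w + 1) (length w + 1)"
  by (simp add: word_matrix_def)

lemma dim_row_word_matrix [simp]: "dim_row (word_matrix w a) = length w + 1"
  by (simp add: word_matrix_def)

lemma word_prod_word_matrix_carrier:
  "word_prod (word_matrix w) u \<in> carrier_mat (length w + 1) (length w + 1)"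
  by (induction u) (auto intro: mult_carrier_mat word_matrix_carrier)

text \<open>Each factor moves a basis vector one step up if its letter matches \<open>w\<close>, and
  the rightmost letter acts first. The only path from q_j to q_i therefore spells one subword of
  \<open>w\<close>. The condition j <= i is essential: above the diagonal the formula would give the
  empty word.\<close>

lemma index_word_prod_word_matrix:
  assumes "i \<le> length w" "j \<le> length w"
  shows "word_prod (word_matrix w) u $$ (i, j) =
    (if j \<le> i \<and> u = drop (length w - i) (take (length w - j) w) then 1 else 0)"
  using assms(1)
proof (induction u arbitrary: i)
  case Nil
  thus ?case using assms(2) by auto
next
  case (Cons a u)
  let ?n = "length w" and ?P = "word_prod (word_matrix w) u"
  have "word_prod (word_matrix w) (a # u) $$ (i, j) = row (word_matrix w a) i \<bullet> col ?P j"
    using Cons.prems assms word_prod_word_matrix_carrier [of w u] by simp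
  also have "\<dots> = (\<Sum>k<?n + 1. word_matrix w a $$ (i, k) * ?P $$ (k, j))"
    using Cons.prems assms word_prod_word_matrix_carrier [of w u]
    by (auto simp: scalar_prod_def atLeast0LessThan word_matrix_def intro!: sum.cong)
  \<comment> \<open>In row 0 truncated subtraction would make i - 1 equal to 0, hence the separate
    condition on i.\<close>
  also have "\<dots> = (\<Sum>k<?n + 1. if k = i - 1 \<and> i \<noteq> 0 \<and> w ! (?n - i) = a then ?P $$ (i - 1, j) else 0)"
    using Cons.prems by (intro sum.cong refl) (auto simp: word_matrix_def)
  also have "\<dots> = (if i \<noteq> 0 \<and> w ! (?n - i) = a then ?P $$ (i - 1, j) else 0)"
    using Cons.prems by auto
  also have "\<dots> = (if j \<le> i \<and> a # u = drop (?n - i) (take (?n - j) w) then 1 else 0)"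
  proof (cases "j < i")
    case True
    have "?n - (i - 1) = Suc (?n - i)" using True Cons.prems by simp
    moreover have "drop (?n - i) (take (?n - j) w) =
        w ! (?n - i) # drop (Suc (?n - i)) (take (?n - j) w)"
      using True Cons.prems by (subst Cons_nth_drop_Suc [symmetric]) auto
    ultimately show ?thesis using True Cons.IH [of "i - 1"] Cons.prems by auto
  next
    case False
    hence "drop (?n - i) (take (?n - j) w) = []" by simp
    thus ?thesis using False Cons.IH [of "i - 1"] Cons.prems by auto
  qed
  finally show ?case .
qed

lemma nc_eval_word_matrix:
  "nc_eval (word_matrix w) f = mat (length w + 1) (length w + 1)
    (\<lambda>(i, j). if j \<le> i then nc_coeff f (drop (length w - i) (take (length w - j) w)) else 0)"
proof (rule eq_matI)
  fix i j assume ij: "i < dim_row (mat (length w + 1) (length w + 1)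
      (\<lambda>(i, j). if j \<le> i then nc_coeff f (drop (length w - i) (take (length w - j) w)) else 0))"
    "j < dim_col (mat (length w + 1) (length w + 1)
      (\<lambda>(i, j). if j \<le> i then nc_coeff f (drop (length w - i) (take (length w - j) w)) else 0))"
  let ?v = "drop (length w - i) (take (length w - j) w)"
  have "(\<Sum>\<^sub>\<infinity>u. nc_coeff f u * word_prod (word_matrix w) u $$ (i, j)) =
      nc_coeff f ?v * word_prod (word_matrix w) ?v $$ (i, j)"
    by (subst infsum_cong_neutral [of "{?v}" UNIV]) (use ij in \<open>auto simp: index_word_prod_word_matrix\<close>)
  thus "nc_eval (word_matrix w) f $$ (i, j) = mat (length w + 1) (length w + 1)
      (\<lambda>(i, j). if j \<le> i then nc_coeff f (drop (length w - i) (take (length w - j) w)) else 0) $$ (i, j)"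
    using ij by (simp add: nc_eval_def index_word_prod_word_matrix)
qed (simp_all add: nc_eval_def)

text \<open>An intermediate index k between j and i in the matrix product is a splitting of the
  subword, with a prefix of length i - k.\<close>

lemma nc_eval_mult:
  "nc_eval (word_matrix w) (f * g) = nc_eval (word_matrix w) f * nc_eval (word_matrix w) g"
proof (rule eq_matI)
  let ?n = "length w"
  let ?s = "\<lambda>i j. drop (?n - i) (take (?n - j) w)"
  fix i j assume "i < dim_row (nc_eval (word_matrix w) f * nc_eval (word_matrix w) g)"
    "j < dim_col (nc_eval (word_matrix w) f * nc_eval (word_matrix w) g)"
  hence ij: "i \<le> ?n" "j \<le> ?n" by (simp_all add: nc_eval_word_matrix)
  have "(nc_eval (word_matrix w) f * nc_eval (word_matrix w) g) $$ (i, j) =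
      (\<Sum>k<?n + 1. (if k \<le> i then nc_coeff f (?s i k) else 0) * (if j \<le> k then nc_coeff g (?s k j) else 0))"
    using ij by (simp add: nc_eval_word_matrix scalar_prod_def atLeast0LessThan del: sum.lessThan_Suc)
  also have "\<dots> = (\<Sum>k\<in>{j..i}. nc_coeff f (?s i k) * nc_coeff g (?s k j))"
    using ij by (intro sum.mono_neutral_cong_right) auto
  also have "\<dots> = (if j \<le> i then nc_coeff (f * g) (?s i j) else 0)"
  proof (cases "j \<le> i")
    case True
    have "(\<Sum>k\<in>{j..i}. nc_coeff f (?s i k) * nc_coeff g (?s k j)) =
        (\<Sum>l\<le>i - j. nc_coeff f (take l (?s i j)) * nc_coeff g (drop l (?s i j)))"
    proof (rule sum.reindex_bij_witness [of _ "\<lambda>l. i - l" "\<lambda>k. i - k"])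
      fix k assume k: "k \<in> {j..i}"
      hence "i - k + (?n - i) = ?n - k" "min (?n - j) (?n - k) = ?n - k" using ij by auto
      thus "nc_coeff f (take (i - k) (?s i j)) * nc_coeff g (drop (i - k) (?s i j)) =
          nc_coeff f (?s i k) * nc_coeff g (?s k j)"
        by (simp add: take_drop min.commute)
    qed (use True in auto)
    moreover have "length (?s i j) = i - j" using True ij by simp
    ultimately show ?thesis using True by (simp only: nc_coeff_mult if_True)
  qed simp
  also have "\<dots> = nc_eval (word_matrix w) (f * g) $$ (i, j)"
    using ij by (simp add: nc_eval_word_matrix)
  finally show "nc_eval (word_matrix w) (f * g) $$ (i, j) =
      (nc_eval (word_matrix w) f * nc_eval (word_matrix w) g) $$ (i, j)" ..
qed (simp_all add: nc_eval_word_matrix)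

lemma nc_eval_one: "nc_eval (word_matrix w) 1 = 1\<^sub>m (length w + 1)"
  by (rule eq_matI) (auto simp: nc_eval_word_matrix nc_coeff_one)

lemma nc_eval_var: "nc_eval (word_matrix w) (nc_var a) = word_matrix w a"
proof (rule eq_matI)
  fix i j assume "i < dim_row (word_matrix w a)" "j < dim_col (word_matrix w a)"
  hence ij: "i \<le> length w" "j \<le> length w" by (simp_all add: word_matrix_def)
  have "word_prod (word_matrix w) [a] = word_matrix w a"
    using right_mult_one_mat [OF word_matrix_carrier] by simp
  thus "nc_eval (word_matrix w) (nc_var a) $$ (i, j) = word_matrix w a $$ (i, j)"
    using index_word_prod_word_matrix [OF ij, of "[a]"] ij
    by (auto simp: nc_eval_word_matrix nc_var_def)
qed (simp_all add: nc_eval_word_matrix word_matrix_def)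

lemma nc_eval_power:
  "nc_eval (word_matrix w) (f ^ m) = nc_eval (word_matrix w) f ^\<^sub>m m"
proof (induction m)
  case 0
  show ?case by (simp add: nc_eval_one) (simp add: nc_eval_word_matrix)
next
  case (Suc m)
  thus ?case by (simp add: power_Suc2 nc_eval_mult del: power_Suc)
qed

section \<open>The Hodge defect as an evaluated series\<close>

lemma nc_coeff_smult_var_power:
  "nc_coeff (nc_smult c (nc_var a) ^ m) w = (if w = replicate m a then c ^ m else 0)"
proof (induction m arbitrary: w)
  case 0
  show ?case by (simp add: nc_coeff_one)
next
  case (Suc m)
  show ?case by (cases w) (auto simp: nc_smult_mult_left Suc)
qed

lemma hodge_defect_matrix_eq:
  "hodge_defect_matrix (word_matrix w) =
    nc_eval (word_matrix w) ((1 + e0 - e1) * G1_integral * U_e1)"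
proof -
  let ?N = "word_matrix w" and ?n = "length w" and ?c = "- 2 * of_real pi * \<i>"
  let ?s = "\<lambda>i j. drop (?n - i) (take (?n - j) w)"
  have "1\<^sub>m (?n + 1) + ?N L0 - ?N L1 = nc_eval ?N (1 + e0 - e1)"
  proof -
    have "nc_eval ?N (1 + e0 - e1) = nc_eval ?N 1 + nc_eval ?N e0 - nc_eval ?N e1"
      by (rule eq_matI) (auto simp: nc_eval_word_matrix)
    thus ?thesis by (simp add: nc_eval_one nc_eval_var)
  qed
  moreover have "mat (?n + 1) (?n + 1) (\<lambda>(i, j). LINT t:{0<..<1}|lborel. nc_eval ?N (G1 t) $$ (i, j)) =
      nc_eval ?N G1_integral"
    by (rule eq_matI) (auto simp: nc_eval_word_matrix G1_integral_def)
  moreover have "mat (?n + 1) (?n + 1) (\<lambda>(i, j). \<Sum>m. ((?c \<cdot>\<^sub>m ?N L1) ^\<^sub>m m) $$ (i, j) / fact (m + 1)) =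
      nc_eval ?N U_e1"
  proof (rule eq_matI)
    fix i j assume "i < dim_row (nc_eval ?N U_e1)" "j < dim_col (nc_eval ?N U_e1)"
    hence ij: "i \<le> ?n" "j \<le> ?n" by (simp_all add: nc_eval_word_matrix)
    have smult: "nc_eval ?N (nc_smult ?c e1) = ?c \<cdot>\<^sub>m ?N L1"
      unfolding nc_eval_var [of w L1, symmetric] by (rule eq_matI) (auto simp: nc_eval_word_matrix)
    \<comment> \<open>Each matrix entry belongs to a single subword, so only the power m equal to
      its length can contribute and the series reduces to one term.\<close>
    have "((?c \<cdot>\<^sub>m ?N L1) ^\<^sub>m m) $$ (i, j) / fact (m + 1) = (if m = length (?s i j) then
        if j \<le> i \<and> ?s i j = replicate (length (?s i j)) L1 then ?c ^ m / fact (m + 1) else 0 else 0)" for m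
    proof -
      have "?s i j = replicate m L1 \<longleftrightarrow> m = length (?s i j) \<and> ?s i j = replicate (length (?s i j)) L1"
        by (metis length_replicate)
      thus ?thesis
        unfolding smult [symmetric] nc_eval_power [symmetric] using ij
        by (auto simp: nc_eval_word_matrix nc_coeff_smult_var_power)
    qed
    hence "(\<lambda>m. ((?c \<cdot>\<^sub>m ?N L1) ^\<^sub>m m) $$ (i, j) / fact (m + 1)) sums
        (if j \<le> i \<and> ?s i j = replicate (length (?s i j)) L1
         then ?c ^ length (?s i j) / fact (length (?s i j) + 1) else 0)"
      using sums_single [of "length (?s i j)" "\<lambda>m. if j \<le> i \<and> ?s i j = replicate (length (?s i j)) L1
          then ?c ^ m / fact (m + 1) else 0"] by (simp only:)
    also have "(if j \<le> i \<and> ?s i j = replicate (length (?s i j)) L1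
        then ?c ^ length (?s i j) / fact (length (?s i j) + 1) else 0) = nc_eval ?N U_e1 $$ (i, j)"
      using ij by (simp add: nc_eval_word_matrix U_e1_def nc_coeff_letter_series)
    finally show "mat (?n + 1) (?n + 1)
        (\<lambda>(i, j). \<Sum>m. ((?c \<cdot>\<^sub>m ?N L1) ^\<^sub>m m) $$ (i, j) / fact (m + 1)) $$ (i, j) = nc_eval ?N U_e1 $$ (i, j)"
      using ij by (simp only: index_mat split sums_unique [symmetric] less_Suc_eq_le Suc_eq_plus1 [symmetric])
  qed (simp_all add: nc_eval_word_matrix)
  ultimately show ?thesis
    by (simp only: hodge_defect_matrix_def Let_def dim_row_word_matrix nc_eval_mult)
qed

text \<open>Uniqueness: the corner entry in row \<open>length w\<close> and column 0 recovers the
  coefficient at \<open>w\<close>.\<close>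

lemma hodge_defect_series_eq: "hodge_defect_series = (1 + e0 - e1) * G1_integral * U_e1"
  unfolding hodge_defect_series_def
proof (rule the_equality)
  fix G assume G: "\<forall>w. nc_eval (word_matrix w) G = hodge_defect_matrix (word_matrix w)"
  have corner: "nc_eval (word_matrix w) f $$ (length w, 0) = nc_coeff f w" for f w
    by (simp add: nc_eval_word_matrix)
  show "G = (1 + e0 - e1) * G1_integral * U_e1"
    by (rule ncps_eqI) (simp only: corner [symmetric] G hodge_defect_matrix_eq)
qed (simp add: hodge_defect_matrix_eq)

section \<open>The formula for the Hodge defect\<close>

text \<open>Reading f g = 1 on words beginning with \<open>L1\<close> gives g_1 = -f_1 g, where f_1
  and g_1 are the tails; hence (1 + e_0 f_0) g = f g - e_1 f_1 g = 1 + e_1 g_1.\<close>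

lemma nc_tail_inverse:
  assumes "nc_coeff f [] = 1" "nc_coeff g [] = 1" "f * g = 1"
  shows "(1 + e0 * nc_tail L0 f) * g = 1 + e1 * nc_tail L1 g"
proof -
  have "nc_tail L1 g = - (nc_tail L1 f * g)"
  proof (rule ncps_eqI)
    fix u
    have "nc_coeff (f * g) (L1 # u) = 0" unfolding assms(3) by (simp add: nc_coeff_one)
    thus "nc_coeff (nc_tail L1 g) u = nc_coeff (- (nc_tail L1 f * g)) u"
      using assms(1,2) by (simp add: nc_coeff_mult_Cons uminus_ncps_def add_eq_0_iff2)
  qed
  moreover have "(1 + e0 * nc_tail L0 f) * g = f * g - e1 * nc_tail L1 f * g"
    using arg_cong [OF nc_tail_decomp [OF assms(1)], of "\<lambda>h. h * g"] by (simp add: distrib_right)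
  ultimately show ?thesis using assms(3) by (simp add: mult.assoc)
qed

lemma U_e1_in_mzv_algebra: "nc_coeff U_e1 w \<in> mzv_algebra"
proof -
  have "- (2 * of_real pi * \<i>) \<in> mzv_algebra"
    unfolding mzv_algebra_def by (intro uminus_in_rat_algebra rat_algebra.gen) simp
  hence "- 2 * of_real pi * \<i> \<in> mzv_algebra" by simp
  hence "(- 2 * of_real pi * \<i>) ^ m / of_nat (fact (m + 1)) \<in> mzv_algebra" for m
    unfolding mzv_algebra_def by (intro divide_nat_in_rat_algebra power_in_rat_algebra)
  moreover have "0 \<in> mzv_algebra"
    using of_nat_in_rat_algebra [of 0] by (simp add: mzv_algebra_def)
  ultimately show ?thesis
    by (simp add: U_e1_def nc_coeff_letter_series del: fact_Suc)
qed

theorem theorem1: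
  "(\<exists>a0 a1 b0 b1.
      associator = 1 + e0 * a0 + e1 * a1 \<and>
      nc_inv associator = 1 + e0 * b0 + e1 * b1 \<and>
      hodge_defect_series = (1 + e0 * a0) * nc_inv associator * U_e1 \<and>
      hodge_defect_series = (1 + e1 * b1) * U_e1 \<and>
      hodge_defect_series * nc_inv U_e1 = 1 + e1 * b1) \<and>
   (\<forall>w. nc_coeff hodge_defect_series w \<in> mzv_algebra) \<and>
   (\<forall>w. nc_coeff (hodge_defect_series * nc_inv U_e1) w =
      (if w = [] \<or> (\<exists>u. w = L1 # u) then nc_coeff (nc_inv associator) w else 0))"
proof -
  let ?A = "associator"
  let ?B = "nc_inv ?A"
  let ?S = "1 + e1 * nc_tail L1 ?B"
  note A0 = nc_coeff_associator_Nil
  note B0 = nc_coeff_inv_Nil [OF A0]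
  have series: "hodge_defect_series = ?S * U_e1"
    by (simp add: hodge_defect_series_eq G1_integral)
  have "nc_coeff U_e1 [] = 1" by (simp add: U_e1_def nc_coeff_letter_series)
  hence inv: "hodge_defect_series * nc_inv U_e1 = ?S"
    by (simp add: series mult.assoc nc_mult_inv)
  have S: "nc_coeff ?S w = (if w = [] \<or> (\<exists>u. w = L1 # u) then nc_coeff ?B w else 0)" for w
    by (cases w) (auto simp: nc_coeff_one B0)
  have "nc_coeff ?S w \<in> mzv_algebra" for w
  proof -
    have "0 \<in> mzv_algebra" "1 \<in> mzv_algebra"
      using of_nat_in_rat_algebra [of 0] of_nat_in_rat_algebra [of 1] by (simp_all add: mzv_algebra_def)
    thus ?thesis unfolding S using inv_associator_in_mzv_algebra by (auto simp: B0)
  qed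
  hence "nc_coeff hodge_defect_series w \<in> mzv_algebra" for w
    unfolding series nc_coeff_mult using U_e1_in_mzv_algebra unfolding mzv_algebra_def
    by (intro sum_in_rat_algebra rat_algebra.mult) auto
  moreover have "(1 + e0 * nc_tail L0 ?A) * ?B = ?S"
    by (rule nc_tail_inverse [OF A0 B0 nc_mult_inv [OF A0]])
  ultimately show ?thesis
    using nc_tail_decomp [OF A0] nc_tail_decomp [OF B0] series inv S
    by (intro conjI exI [of _ "nc_tail L0 ?A"] exI [of _ "nc_tail L1 ?A"]
        exI [of _ "nc_tail L0 ?B"] exI [of _ "nc_tail L1 ?B"] allI) (simp_all only:)
qed

end
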